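(* Let $\tilde w:\mathbb Z_+\to\mathbb R^{n_w}$ and $\tilde x_i=\bar x_i+v_i:\mathbb Z_+\to\mathbb R^{n_x}$, $i\in\{1,\dots,N\}$, be random signals satisfying assumptions (A1), (A2), (A3) of the context. Fix $\delta>0$, a function $\Pi:\mathbb R^{4n_x+n_w}\to\mathbb R^{n_\Pi}$ and a finite $\kappa\in(0,\infty)$. For each $T$ let $(\theta_T,r_T,R_T)$ be the optimizing triple $(\hat\theta,\hat r,\hat R)$ found by applying algorithm $\mathcal A(\delta,\Pi,\kappa)$ to the data set $\Xi_T$. Then for every $\epsilon>0$ and $\gamma\in(0,1)$ there exists $T$ such that, with probability at least $1-\gamma$, $$\epsilon+\operatorname{tr}(R\bar M_T)\;\ge\;\operatorname{tr}(R_T\bar M_T)\;\ge\;\frac1N\sum_{i=1}^N J^{SE}_T\big(a_{\theta_T},\bar x_i(0),\bar x_i^{(T)},\tilde w^{(T)}\big)$$ holds for all $(\theta,r,R)$ feasible for the optimization problem in step (iii) of $\mathcal A(\delta,\Pi,\kappa)$.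
   Context: **Notation.** $\mathbb Z_+$ is the set of nonnegative integers. $A'$ is the transpose of $A$; $[a;b]$ is vertical concatenation; $[R]_{a,b}$ and $[v]_d$ are matrix and vector entries; $|v|_R^2=v'Rv$ for symmetric $R$; $|v|^2=v'v$; $\|R\|_F$ is the Frobenius norm; $A\ge B$ for symmetric matrices means $A-B$ is positive semidefinite. For $\alpha\in\mathbb Z_+^n$, $v\in\mathbb R^n$: $v^\alpha=\prod_d [v]_d^{[\alpha]_d}$ and $\|\alpha\|_1=\sum_d[\alpha]_d$. Let $n_z=2n_x+n_w$. For a signal $s$ on $\mathbb Z_+$, $s^{(T)}$ is its restriction to $\{0,\dots,T\}$. **Models.** Fix positive integers $n_x,n_w,n_y,n_\theta,N$, a matrix $C\in\mathbb R^{n_y\times n_x}$, and real analytic functions $\phi_i:\mathbb R^{n_x}\times\mathbb R^{n_w}\to\mathbb R^{n_x}$, $\psi_i:\mathbb R^{n_x}\to\mathbb R^{n_x}$, $i=1,\dots,n_\theta$. For $\theta\in\mathbb R^{n_\theta}$ put $f_\theta(x,w)=\sum_i[\theta]_i\phi_i(x,w)$, $e_\theta(x)=\sum_i[\theta]_i\psi_i(x)$, and, when $e_\theta$ is a bijection (which is the case for all $\theta$ appearing in $\mathbf\Theta(N,\delta,\Pi)$ below), $a_\theta(x,w)=e_\theta^{-1}(f_\theta(x,w))$. For $a:\mathbb R^{n_x}\times\mathbb R^{n_w}\to\mathbb R^{n_x}$, $G_a(x_0,w)$ denotes the sequence $x$ with $x(0)=x_0$ and $x(t)=a(x(t-1),w(t))$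 for $t\ge1$. The $T$-step simulation error is $$J^{SE}_T(a,x_0,\tilde x,\tilde w)=\frac1T\sum_{t=0}^{T-1}|C(\tilde x(t)-x(t))|^2,\qquad x=G_a(x_0,\tilde w).$$ **The set $\mathbf\Theta(N,\delta,\Pi)$.** Let $\mathcal P_N$ be the set of real polynomials in $z=[\xi;x;w]\in\mathbb R^{n_z}$ ($\xi,x\in\mathbb R^{n_x}$, $w\in\mathbb R^{n_w}$) of total degree at most $N$. Let $v=[\xi;x;w;\Delta;q]$ with $\Delta,q\in\mathbb R^{n_x}$. $\mathbf\Theta(N,\delta,\Pi)$ is the set of pairs $(\theta,r)\in\mathbb R^{n_\theta}\times\mathcal P_N$ for which there exist symmetric $P\in\mathbb R^{n_x\times n_x}$, symmetric $\Sigma_1,\Sigma_2\in\mathbb R^{n_\Pi\times n_\Pi}$ and a scalar $\epsilon>0$ with $P\ge\delta I$, $\Sigma_1\ge0$, $\Sigma_2\ge0$ and, identically in $v$, $$r(z)+2\Delta'[e_\theta(x+\Delta)-e_\theta(x)]-|\Delta|^2_{P+C'C}+|q|_P^2-2q'(f_\theta(x+\Delta,w)-e_\theta(\xi))=\Pi(v)'\Sigma_1\Pi(v),$$ $$2\Delta'[e_\theta(x+\Delta)-e_\theta(x)]-|\Delta|^2_{P+\epsilon I}+|q|_P^2-2q'(f_\theta(x+\Delta,w)-f_\theta(x,w))=\Pi(v)'\Sigma_2\Pi(v).$$ **Moments.** For a data set $\Xi=(\tilde w,\tilde x_1,\dots,\tilde x_N)$ of signals on $\{0,\dots,T\}$ let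 $\tilde z_i(t)=[\tilde x_i(t);\tilde x_i(t-1);\tilde w(t)]$. For $\alpha\in\mathbb Z_+^{n_z}$ with $\|\alpha\|_1\le N$, the linearized empirical moment is $$\tilde\mu_\alpha(\Xi)=\frac1T\sum_{t=1}^T\prod_{i=1}^{\|\alpha\|_1}[\tilde z_i(t)]_{\beta_\alpha(i)},\qquad \beta_\alpha(i)=\min\Big\{d\in\{1,\dots,n_z\}:\sum_{j=1}^d[\alpha]_j\ge i\Big\}.$$ For single signals, $\mu_\alpha(\bar x,\tilde w)=\frac1T\sum_{t=1}^T[\bar x(t);\bar x(t-1);\tilde w(t)]^\alpha$. Let $\aleph=\{\alpha\in\mathbb Z_+^{n_z}:2\|\alpha\|_1\le N\}=\{\alpha_1,\dots,\alpha_{|\aleph|}\}$. **Algorithm $\mathcal A(\delta,\Pi,\kappa)$** (input: data set $\Xi$). (i) Fix $\delta>0$, $\Pi$, and $\kappa\in(0,\infty]$. (ii) Form $\tilde M_\Xi\in\mathbb R^{|\aleph|\times|\aleph|}$, $[\tilde M_\Xi]_{j_1,j_2}=\tilde\mu_{\alpha_{j_1}+\alpha_{j_2}}(\Xi)$, and let $\hat M_\Xi$ be the projection of $\frac12(\tilde M_\Xi+\tilde M_\Xi')$ onto the closed convex cone of positive semidefinite matrices. (iii) Find $\theta\in\mathbb R^{n_\theta}$, $r\in\mathcal P_N$ and $R=R'\in\mathbb R^{|\aleph|\times|\aleph|}$ minimizing $\operatorname{tr}(R\hat M_\Xi)$ subject to $(\theta,r)\in\mathbf\Theta(N,\delta,\Pi)$,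 $r(z)=\sum_{j_1,j_2}[R]_{j_1,j_2}z^{\alpha_{j_1}+\alpha_{j_2}}$ and $\|R\|_F^2\le\kappa$; take $(\hat\theta,\hat r,\hat R)$ to be an optimizing $(\theta,r,R)$ (the algorithm presupposes that one exists). **Data.** $\Xi_T=(\tilde w^{(T)},\tilde x_1^{(T)},\dots,\tilde x_N^{(T)})$, where $\tilde x_i=\bar x_i+v_i$ and: - (A1) $\tilde w(t)$ is a stochastic process, uniformly bounded in $t$. - (A2) Each $v_i$ is a bounded, zero-mean process with values in $\mathbb R^{n_x}$, i.i.d. in $t$; $v_1,\dots,v_N$ are mutually independent, and jointly independent of $(\tilde w,\bar x_1,\dots,\bar x_N)$. - (A3) The $\bar x_i$ are stochastic processes, uniformly bounded in $i$ and $t$, and there are constants $c>0$, $\rho\in(0,1)$ such that almost surely $|\bar x_i(t)-\bar x_j(t)|\le c\rho^t$ for all $i,j\in\{1,\dots,N\}$, $t\in\mathbb Z_+$. The noiseless moment matrix is $[\bar M_T]_{j_1,j_2}=\frac1N\sum_{i=1}^N\mu_{\alpha_{j_1}+\alpha_{j_2}}(\bar x_i^{(T)},\tilde w^{(T)})$. *)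

theory Defs
  imports "HOL-Probability.Probability"
begin

text \<open>Coordinate index types carry the class \<^class>\<open>enum\<close>, whose enumeration numbers the coordinates
  1, 2, \dots. On sum types this enumeration lists the left summand first, so it agrees with
  vertical concatenation.\<close>

definition coord :: "nat \<Rightarrow> 'n::enum"
  where "coord d = enum_class.enum ! (d - 1)"

definition vcat :: "real ^ 'a \<Rightarrow> real ^ 'b \<Rightarrow> real ^ ('a + 'b)"  (infixr "\<frown>" 70)
  where "u \<frown> v = (\<chi> k. case k of Inl a \<Rightarrow> u $ a | Inr b \<Rightarrow> v $ b)"

definition vpow :: "real ^ 'n \<Rightarrow> nat ^ 'n \<Rightarrow> real"
  where "vpow v \<alpha> = (\<Prod>d\<in>UNIV. (v $ d) ^ (\<alpha> $ d))"

definition mdeg :: "nat ^ 'n \<Rightarrow> nat"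
  where "mdeg \<alpha> = (\<Sum>d\<in>UNIV. \<alpha> $ d)"

text \<open>Real polynomials are identified with the functions they induce.\<close>

definition polys_upto :: "nat \<Rightarrow> (real ^ 'n \<Rightarrow> real) set"
  where "polys_upto N = {r. \<exists>c. \<forall>z. r z = (\<Sum>\<alpha> | mdeg \<alpha> \<le> N. c \<alpha> * vpow z \<alpha>)}"

text \<open>Around every point, the function is the sum of a multivariate power series in the coordinates
  with respect to \<^const>\<open>Basis\<close>; \<^const>\<open>has_sum\<close> is unconditional convergence.\<close>

definition real_analytic :: "('a::euclidean_space \<Rightarrow> 'b::euclidean_space) \<Rightarrow> bool"
  where "real_analytic f \<longleftrightarrow>
    (\<forall>p. \<exists>\<rho>>0. \<exists>c :: ('a \<Rightarrow> nat) \<Rightarrow> 'b. \<forall>h\<in>ball 0 \<rho>.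
      ((\<lambda>\<alpha>. (\<Prod>b\<in>Basis. (h \<bullet> b) ^ \<alpha> b) *\<^sub>R c \<alpha>) has_sum f (p + h)) (Basis \<rightarrow>\<^sub>E UNIV))"

definition psd :: "real ^ 'n ^ 'n \<Rightarrow> bool"
  where "psd A \<longleftrightarrow> transpose A = A \<and> (\<forall>v. 0 \<le> v \<bullet> (A *v v))"

definition qnorm :: "real ^ 'n ^ 'n \<Rightarrow> real ^ 'n \<Rightarrow> real"
  where "qnorm R v = v \<bullet> (R *v v)"


section \<open>Models\<close>

definition f_model ::
  "('k::finite \<Rightarrow> (real ^ 'x) \<times> (real ^ 'w) \<Rightarrow> real ^ 'x) \<Rightarrow> real ^ 'k \<Rightarrow> real ^ 'x \<Rightarrow> real ^ 'w \<Rightarrow> real ^ 'x"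
  where "f_model \<phi> \<theta> x w = (\<Sum>i\<in>UNIV. (\<theta> $ i) *\<^sub>R \<phi> i (x, w))"

definition e_model :: "('k::finite \<Rightarrow> real ^ 'x \<Rightarrow> real ^ 'x) \<Rightarrow> real ^ 'k \<Rightarrow> real ^ 'x \<Rightarrow> real ^ 'x"
  where "e_model \<psi> \<theta> x = (\<Sum>i\<in>UNIV. (\<theta> $ i) *\<^sub>R \<psi> i x)"

text \<open>Meaningful only when \<open>e_model \<psi> \<theta>\<close> is a bijection.\<close>

definition a_model ::
  "('k::finite \<Rightarrow> (real ^ 'x) \<times> (real ^ 'w) \<Rightarrow> real ^ 'x) \<Rightarrow> ('k \<Rightarrow> real ^ 'x \<Rightarrow> real ^ 'x) \<Rightarrow>
    real ^ 'k \<Rightarrow> real ^ 'x \<Rightarrow> real ^ 'w \<Rightarrow> real ^ 'x"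
  where "a_model \<phi> \<psi> \<theta> x w = inv (e_model \<psi> \<theta>) (f_model \<phi> \<theta> x w)"

primrec G_sim ::
  "(real ^ 'x \<Rightarrow> real ^ 'w \<Rightarrow> real ^ 'x) \<Rightarrow> real ^ 'x \<Rightarrow> (nat \<Rightarrow> real ^ 'w) \<Rightarrow> nat \<Rightarrow> real ^ 'x"
  where
    "G_sim a x0 w 0 = x0"
  | "G_sim a x0 w (Suc t) = a (G_sim a x0 w t) (w (Suc t))"

definition J_SE ::
  "real ^ 'x ^ 'y \<Rightarrow> nat \<Rightarrow> (real ^ 'x \<Rightarrow> real ^ 'w \<Rightarrow> real ^ 'x) \<Rightarrow> real ^ 'x \<Rightarrow>
    (nat \<Rightarrow> real ^ 'x) \<Rightarrow> (nat \<Rightarrow> real ^ 'w) \<Rightarrow> real"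
  where "J_SE C T a x0 x w =
    (1 / real T) * (\<Sum>t<T. (norm (C *v (x t - G_sim a x0 w t)))\<^sup>2)"

definition Theta ::
  "real ^ 'x ^ 'y \<Rightarrow> ('k::finite \<Rightarrow> (real ^ 'x) \<times> (real ^ 'w) \<Rightarrow> real ^ 'x) \<Rightarrow>
    ('k \<Rightarrow> real ^ 'x \<Rightarrow> real ^ 'x) \<Rightarrow> nat \<Rightarrow> real \<Rightarrow>
    (real ^ ('x + 'x + 'w + 'x + 'x) \<Rightarrow> real ^ 'p) \<Rightarrow>
    ((real ^ 'k) \<times> (real ^ ('x + 'x + 'w) \<Rightarrow> real)) set"
  where "Theta C \<phi> \<psi> N \<delta> Pi_map = {(\<theta>, r). r \<in> polys_upto N \<and>
    (\<exists>P S1 S2 \<epsilon>. transpose P = P \<and> psd (P - mat \<delta>) \<and> psd S1 \<and> psd S2 \<and> \<epsilon> > 0 \<and>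
      (\<forall>\<xi> x w \<Delta> q.
        r (\<xi> \<frown> x \<frown> w) + 2 * (\<Delta> \<bullet> (e_model \<psi> \<theta> (x + \<Delta>) - e_model \<psi> \<theta> x))
          - qnorm (P + transpose C ** C) \<Delta> + qnorm P q
          - 2 * (q \<bullet> (f_model \<phi> \<theta> (x + \<Delta>) w - e_model \<psi> \<theta> \<xi>))
        = qnorm S1 (Pi_map (\<xi> \<frown> x \<frown> w \<frown> \<Delta> \<frown> q)) \<and>
        2 * (\<Delta> \<bullet> (e_model \<psi> \<theta> (x + \<Delta>) - e_model \<psi> \<theta> x))
          - qnorm (P + mat \<epsilon>) \<Delta> + qnorm P q
          - 2 * (q \<bullet> (f_model \<phi> \<theta> (x + \<Delta>) w - f_model \<phi> \<theta> x w))
        = qnorm S2 (Pi_map (\<xi> \<frown> x \<frown> w \<frown> \<Delta> \<frown> q))))}"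


section \<open>Moments\<close>

text \<open>A signal on \<open>{0..T}\<close> is represented by a function on all of \<^typ>\<open>nat\<close>; only its values at times
  up to \<open>T\<close> are ever used. In a data set, \<open>x i\<close> is the signal of experiment \<open>i \<in> {1..N}\<close>.\<close>

definition beta :: "nat ^ 'n::enum \<Rightarrow> nat \<Rightarrow> nat"
  where "beta \<alpha> i = Min {d \<in> {1..CARD('n)}. i \<le> (\<Sum>j=1..d. \<alpha> $ coord j)}"

definition lin_moment ::
  "nat \<Rightarrow> (nat \<Rightarrow> real ^ 'w::enum) \<Rightarrow> (nat \<Rightarrow> nat \<Rightarrow> real ^ 'x::enum) \<Rightarrow> nat ^ ('x + 'x + 'w) \<Rightarrow> real"
  where "lin_moment T w x \<alpha> =
    (1 / real T) * (\<Sum>t=1..T. \<Prod>i=1..mdeg \<alpha>. (x i t \<frown> x i (t - 1) \<frown> w t) $ coord (beta \<alpha> i))"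

definition moment ::
  "nat \<Rightarrow> (nat \<Rightarrow> real ^ 'w) \<Rightarrow> (nat \<Rightarrow> real ^ 'x) \<Rightarrow> nat ^ ('x + 'x + 'w) \<Rightarrow> real"
  where "moment T w x \<alpha> = (1 / real T) * (\<Sum>t=1..T. vpow (x t \<frown> x (t - 1) \<frown> w t) \<alpha>)"

definition aleph :: "nat \<Rightarrow> (nat ^ 'n) set"
  where "aleph N = {\<alpha>. 2 * mdeg \<alpha> \<le> N}"


section \<open>Square matrices with rows and columns indexed by a finite set\<close>

text \<open>Entries outside the index set \<open>I\<close> are 0, so that \<open>mats I\<close> is a copy of the space of
  \<open>card I \<times> card I\<close> matrices.\<close>

definition mats :: "'i set \<Rightarrow> ('i \<Rightarrow> 'i \<Rightarrow> real) set"
  where "mats I = {A. \<forall>i j. i \<notin> I \<or> j \<notin> I \<longrightarrow> A i j = 0}"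

definition mats_sym :: "'i set \<Rightarrow> ('i \<Rightarrow> 'i \<Rightarrow> real) set"
  where "mats_sym I = {A \<in> mats I. \<forall>i j. A i j = A j i}"

definition mats_psd :: "'i set \<Rightarrow> ('i \<Rightarrow> 'i \<Rightarrow> real) set"
  where "mats_psd I = {A \<in> mats_sym I. \<forall>u. 0 \<le> (\<Sum>i\<in>I. \<Sum>j\<in>I. u i * A i j * u j)}"

definition mk_mat :: "'i set \<Rightarrow> ('i \<Rightarrow> 'i \<Rightarrow> real) \<Rightarrow> 'i \<Rightarrow> 'i \<Rightarrow> real"
  where "mk_mat I A i j = (if i \<in> I \<and> j \<in> I then A i j else 0)"

definition tr_mult :: "'i set \<Rightarrow> ('i \<Rightarrow> 'i \<Rightarrow> real) \<Rightarrow> ('i \<Rightarrow> 'i \<Rightarrow> real) \<Rightarrow> real"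
  where "tr_mult I A B = (\<Sum>i\<in>I. \<Sum>j\<in>I. A i j * B j i)"

definition frob :: "'i set \<Rightarrow> ('i \<Rightarrow> 'i \<Rightarrow> real) \<Rightarrow> real"
  where "frob I A = sqrt (\<Sum>i\<in>I. \<Sum>j\<in>I. (A i j)\<^sup>2)"

definition psd_proj :: "'i set \<Rightarrow> ('i \<Rightarrow> 'i \<Rightarrow> real) \<Rightarrow> 'i \<Rightarrow> 'i \<Rightarrow> real"
  where "psd_proj I A = arg_min_on (\<lambda>B. frob I (\<lambda>i j. A i j - B i j)) (mats_psd I)"


section \<open>The identification algorithm\<close>

definition M_tilde ::
  "nat \<Rightarrow> nat \<Rightarrow> (nat \<Rightarrow> real ^ 'w::enum) \<Rightarrow> (nat \<Rightarrow> nat \<Rightarrow> real ^ 'x::enum) \<Rightarrow>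
    nat ^ ('x + 'x + 'w) \<Rightarrow> nat ^ ('x + 'x + 'w) \<Rightarrow> real"
  where "M_tilde N T w x = mk_mat (aleph N) (\<lambda>\<alpha>\<^sub>1 \<alpha>\<^sub>2. lin_moment T w x (\<alpha>\<^sub>1 + \<alpha>\<^sub>2))"

definition M_hat ::
  "nat \<Rightarrow> nat \<Rightarrow> (nat \<Rightarrow> real ^ 'w::enum) \<Rightarrow> (nat \<Rightarrow> nat \<Rightarrow> real ^ 'x::enum) \<Rightarrow>
    nat ^ ('x + 'x + 'w) \<Rightarrow> nat ^ ('x + 'x + 'w) \<Rightarrow> real"
  where "M_hat N T w x =
    psd_proj (aleph N) (\<lambda>\<alpha>\<^sub>1 \<alpha>\<^sub>2. (M_tilde N T w x \<alpha>\<^sub>1 \<alpha>\<^sub>2 + M_tilde N T w x \<alpha>\<^sub>2 \<alpha>\<^sub>1) / 2)"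

definition M_bar ::
  "nat \<Rightarrow> nat \<Rightarrow> (nat \<Rightarrow> real ^ 'w) \<Rightarrow> (nat \<Rightarrow> nat \<Rightarrow> real ^ 'x) \<Rightarrow>
    nat ^ ('x + 'x + 'w) \<Rightarrow> nat ^ ('x + 'x + 'w) \<Rightarrow> real"
  where "M_bar N T w x =
    mk_mat (aleph N) (\<lambda>\<alpha>\<^sub>1 \<alpha>\<^sub>2. (1 / real N) * (\<Sum>i=1..N. moment T w (x i) (\<alpha>\<^sub>1 + \<alpha>\<^sub>2)))"

definition feasible ::
  "real ^ 'x ^ 'y \<Rightarrow> ('k::finite \<Rightarrow> (real ^ 'x) \<times> (real ^ 'w) \<Rightarrow> real ^ 'x) \<Rightarrow>
    ('k \<Rightarrow> real ^ 'x \<Rightarrow> real ^ 'x) \<Rightarrow> nat \<Rightarrow> real \<Rightarrow>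
    (real ^ ('x + 'x + 'w + 'x + 'x) \<Rightarrow> real ^ 'p) \<Rightarrow> ereal \<Rightarrow>
    ((real ^ 'k) \<times> (real ^ ('x + 'x + 'w) \<Rightarrow> real) \<times>
      (nat ^ ('x + 'x + 'w) \<Rightarrow> nat ^ ('x + 'x + 'w) \<Rightarrow> real)) set"
  where "feasible C \<phi> \<psi> N \<delta> Pi_map \<kappa> = {(\<theta>, r, R).
    (\<theta>, r) \<in> Theta C \<phi> \<psi> N \<delta> Pi_map \<and> R \<in> mats_sym (aleph N) \<and>
    (\<forall>z. r z = (\<Sum>\<alpha>\<^sub>1\<in>aleph N. \<Sum>\<alpha>\<^sub>2\<in>aleph N. R \<alpha>\<^sub>1 \<alpha>\<^sub>2 * vpow z (\<alpha>\<^sub>1 + \<alpha>\<^sub>2))) \<and>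
    ereal ((frob (aleph N) R)\<^sup>2) \<le> \<kappa>}"

text \<open>The minimizer need not be unique: an output is any minimizer.\<close>

definition algorithm_output ::
  "real ^ 'x::enum ^ 'y \<Rightarrow> ('k::finite \<Rightarrow> (real ^ 'x::enum) \<times> (real ^ 'w::enum) \<Rightarrow> real ^ 'x::enum) \<Rightarrow>
    ('k \<Rightarrow> real ^ 'x::enum \<Rightarrow> real ^ 'x::enum) \<Rightarrow> nat \<Rightarrow> real \<Rightarrow>
    (real ^ ('x + 'x + 'w + 'x + 'x) \<Rightarrow> real ^ 'p) \<Rightarrow> ereal \<Rightarrow>
    nat \<Rightarrow> (nat \<Rightarrow> real ^ 'w::enum) \<Rightarrow> (nat \<Rightarrow> nat \<Rightarrow> real ^ 'x::enum) \<Rightarrow>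
    (real ^ 'k) \<times> (real ^ ('x + 'x + 'w) \<Rightarrow> real) \<times>
      (nat ^ ('x + 'x + 'w) \<Rightarrow> nat ^ ('x + 'x + 'w) \<Rightarrow> real) \<Rightarrow> bool"
  where "algorithm_output C \<phi> \<psi> N \<delta> Pi_map \<kappa> T w x s \<longleftrightarrow>
    is_arg_min (\<lambda>(\<theta>, r, R). tr_mult (aleph N) R (M_hat N T w x))
      (\<lambda>s. s \<in> feasible C \<phi> \<psi> N \<delta> Pi_map \<kappa>) s"


section \<open>Assumptions on the data\<close>

text \<open>In \<open>v i t \<omega>\<close> (and similarly \<open>xb i t \<omega>\<close>), \<open>i \<in> {1..N}\<close> is the experiment, \<open>t\<close> the time and
  \<open>\<omega>\<close> the outcome.\<close>

definition bounded_process :: "'s measure \<Rightarrow> (nat \<Rightarrow> 's \<Rightarrow> 'b::real_normed_vector) \<Rightarrow> bool"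
  where "bounded_process M X \<longleftrightarrow>
    (\<forall>t. X t \<in> borel_measurable M) \<and> (\<exists>K. AE \<omega> in M. \<forall>t. norm (X t \<omega>) \<le> K)"

definition assm_A1 :: "'s measure \<Rightarrow> (nat \<Rightarrow> 's \<Rightarrow> real ^ 'w) \<Rightarrow> bool"
  where "assm_A1 M w \<longleftrightarrow> bounded_process M w"

text \<open>Joint independence is independence of the generated sigma-algebras
  (\<open>prob_space.indep_var\<close> would require both random variables to have the same value type).\<close>

definition assm_A2 ::
  "'s measure \<Rightarrow> nat \<Rightarrow> (nat \<Rightarrow> 's \<Rightarrow> real ^ 'w) \<Rightarrow> (nat \<Rightarrow> nat \<Rightarrow> 's \<Rightarrow> real ^ 'x) \<Rightarrow>
    (nat \<Rightarrow> nat \<Rightarrow> 's \<Rightarrow> real ^ 'x) \<Rightarrow> bool"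
  where "assm_A2 M N w xb v \<longleftrightarrow>
    (\<forall>i\<in>{1..N}. bounded_process M (v i) \<and>
      (\<forall>t. prob_space.expectation M (v i t) = 0) \<and>
      prob_space.indep_vars M (\<lambda>_. borel) (v i) UNIV \<and>
      (\<forall>t. distr M borel (v i t) = distr M borel (v i 0))) \<and>
    prob_space.indep_vars M (\<lambda>_. \<Pi>\<^sub>M t\<in>UNIV. borel) (\<lambda>i \<omega> t. v i t \<omega>) {1..N} \<and>
    prob_space.indep_set M
      (sets (vimage_algebra (space M) (\<lambda>\<omega>. \<lambda>i\<in>{1..N}. \<lambda>t. v i t \<omega>)
        (\<Pi>\<^sub>M i\<in>{1..N}. \<Pi>\<^sub>M t\<in>UNIV. borel)))
      (sets (vimage_algebra (space M) (\<lambda>\<omega>. (\<lambda>t. w t \<omega>, \<lambda>i\<in>{1..N}. \<lambda>t. xb i t \<omega>))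
        ((\<Pi>\<^sub>M t\<in>UNIV. borel) \<Otimes>\<^sub>M (\<Pi>\<^sub>M i\<in>{1..N}. \<Pi>\<^sub>M t\<in>UNIV. borel))))"

definition assm_A3 :: "'s measure \<Rightarrow> nat \<Rightarrow> (nat \<Rightarrow> nat \<Rightarrow> 's \<Rightarrow> real ^ 'x) \<Rightarrow> bool"
  where "assm_A3 M N xb \<longleftrightarrow>
    (\<forall>i\<in>{1..N}. \<forall>t. xb i t \<in> borel_measurable M) \<and>
    (\<exists>K. AE \<omega> in M. \<forall>i\<in>{1..N}. \<forall>t. norm (xb i t \<omega>) \<le> K) \<and>
    (\<exists>c \<rho>. c > 0 \<and> 0 < \<rho> \<and> \<rho> < 1 \<and>
      (AE \<omega> in M. \<forall>i\<in>{1..N}. \<forall>j\<in>{1..N}. \<forall>t. norm (xb i t \<omega> - xb j t \<omega>) \<le> c * \<rho> ^ t))"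

end

theory Submission
  imports Defs
begin

text \<open>
  The two inequalities have separate reasons.

  The lower bound on the trace holds for every outcome. For a Gram matrix \<open>R\<close> of \<open>r\<close>, the
  trace against the noiseless moment matrix is the average of \<open>r\<close> over the recorded noiseless
  regressors (\<open>tr_mult_M_bar\<close>). The constraint set certifies a dissipation inequality with supply rate
  \<open>r\<close>; along a simulation it telescopes, with a nonnegative storage function that vanishes
  initially (\<open>simulation_error_le_sum\<close>). The simulation makes sense because the implicit map \<open>e_model\<close> is
  continuous and strongly monotone, hence onto (\<open>e_model_surj\<close>).

  The near-optimality is statistical. The algorithm minimizes a trace against the matrix \<open>M_hat\<close>. Since
  feasible \<open>R\<close> are bounded in Frobenius norm, the minimizer is nearly optimal for \<open>M_bar\<close> as
  soon as both matrices are close (\<open>minimizer_near_optimal\<close>). Projection onto the positive semidefinite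
  cone keeps them close, since \<open>M_bar\<close> lies in the cone (\<open>psd_proj_close\<close>, \<open>M_bar_psd\<close>), so it remains to
  show that linearized moments converge in mean square (\<open>lin_moment_consistent\<close>). A linearized
  monomial takes each of its factors from a different experiment. Expanding it in the noise,
  every term with a nonempty noise part has, at distinct times, uncorrelated
  values: the noise factors of different experiments are independent, so each can be averaged
  separately, and within one experiment the noise is white. Hence these terms average out
  (\<open>noise_terms_null\<close>). The term without noise differs from a true moment only because the noiseless signals
  differ between experiments, and these differences decay geometrically (\<open>signal_terms_null\<close>).
\<close>

section \<open>Surjectivity of strongly monotone analytic maps\<close>

lemma finite_sum_summable_on:
  fixes f :: "'i \<Rightarrow> 'a \<Rightarrow> 'b::{topological_comm_monoid_add}"
  assumes "\<And>i. i \<in> I \<Longrightarrow> f i summable_on A"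
  shows "(\<lambda>x. \<Sum>i\<in>I. f i x) summable_on A"
  using assms by (induction I rule: infinite_finite_induct) (auto intro: summable_on_add)

text \<open>At a point \<open>h0\<close> of the ball of convergence with all coordinates equal to \<open>s\<close>, the terms of the power series
are absolutely summable. If \<open>norm h \<le> \<tau> * s\<close> with \<open>\<tau> \<le> 1\<close>, each nonconstant monomial at \<open>h\<close> is at most
\<open>\<tau>\<close> times the same monomial at \<open>h0\<close>. Summing up, the increment of \<open>f\<close> is at most \<open>\<tau>\<close> times a constant.\<close>

lemma real_analytic_continuous:
  fixes f :: "'a::euclidean_space \<Rightarrow> 'b::euclidean_space"
  assumes "real_analytic f"
  shows "continuous_on UNIV f"
proof -
  have "isCont f p" for p
  proof -
    let ?I = "(Basis :: 'a set) \<rightarrow>\<^sub>E (UNIV :: nat set)"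
    define mono where "mono h \<alpha> = (\<Prod>b\<in>Basis. (h \<bullet> b) ^ \<alpha> b)" for h :: 'a and \<alpha> :: "'a \<Rightarrow> nat"
    obtain \<rho> c where \<rho>: "\<rho> > 0"
      and hs: "\<And>h. h \<in> ball 0 \<rho> \<Longrightarrow> ((\<lambda>\<alpha>. mono h \<alpha> *\<^sub>R c \<alpha>) has_sum f (p + h)) ?I"
      using assms unfolding real_analytic_def mono_def by metis
    define s where "s = \<rho> / (2 * DIM('a))"
    define h0 :: 'a where "h0 = (\<Sum>b\<in>Basis. s *\<^sub>R b)"
    have s: "s > 0" using \<rho> by (simp add: s_def)
    have h0b: "h0 \<bullet> b = s" if "b \<in> Basis" for b
      using that by (simp add: h0_def inner_sum_left_Basis)
    have "norm h0 \<le> (\<Sum>b\<in>Basis. \<bar>h0 \<bullet> b\<bar>)" by (rule norm_le_l1)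
    also have "\<dots> = DIM('a) * s" using s by (simp add: h0b)
    also have "\<dots> < \<rho>" using \<rho> by (simp add: s_def)
    finally have h0: "h0 \<in> ball 0 \<rho>" by simp
    have mono_nn: "mono h0 \<alpha> \<ge> 0" for \<alpha>
      using s by (auto simp: mono_def h0b intro!: prod_nonneg)
    have "(\<lambda>\<alpha>. \<Sum>b\<in>Basis. norm ((mono h0 \<alpha> *\<^sub>R c \<alpha>) \<bullet> b)) summable_on ?I"
    proof (rule finite_sum_summable_on)
      fix b :: 'b
      have "((\<lambda>\<alpha>. (mono h0 \<alpha> *\<^sub>R c \<alpha>) \<bullet> b) has_sum (f (p + h0) \<bullet> b)) ?I"
        using has_sum_bounded_linear[OF bounded_linear_inner_left hs[OF h0]] by simp
      then show "(\<lambda>\<alpha>. norm ((mono h0 \<alpha> *\<^sub>R c \<alpha>) \<bullet> b)) summable_on ?I"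
        using summable_on_iff_abs_summable_on_real has_sum_imp_summable by fast
    qed
    then have "(\<lambda>\<alpha>. norm (mono h0 \<alpha> *\<^sub>R c \<alpha>)) summable_on ?I"
      by (rule Infinite_Sum.abs_summable_on_comparison_test') (simp only: real_norm_def norm_le_l1)
    then obtain B where B: "((\<lambda>\<alpha>. norm (mono h0 \<alpha> *\<^sub>R c \<alpha>)) has_sum B) ?I"
      by (auto simp: summable_on_def)
    have lip: "norm (f (p + h) - f p) \<le> norm h / s * B" if h: "norm h \<le> s" for h
    proof -
      define \<tau> where "\<tau> = norm h / s"
      have \<tau>: "0 \<le> \<tau>" "\<tau> \<le> 1" "norm h = \<tau> * s" using s h by (auto simp: \<tau>_def)
      have "s \<le> \<rho> / 2" using \<rho> by (simp add: s_def field_simps)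
      then have hb: "h \<in> ball 0 \<rho>" using h \<rho> by simp
      have "((\<lambda>\<alpha>. mono h \<alpha> *\<^sub>R c \<alpha> - mono 0 \<alpha> *\<^sub>R c \<alpha>) has_sum (f (p + h) - f (p + 0))) ?I"
        using has_sum_add[OF hs[OF hb] has_sum_uminus[THEN iffD2], of "\<lambda>\<alpha>. mono 0 \<alpha> *\<^sub>R c \<alpha>" "- f (p + 0)"] hs[of 0] \<rho> by simp
      moreover have "((\<lambda>\<alpha>. \<tau> * norm (mono h0 \<alpha> *\<^sub>R c \<alpha>)) has_sum (\<tau> * B)) ?I"
        by (rule has_sum_cmult_right[OF B])
      moreover have "norm (mono h \<alpha> *\<^sub>R c \<alpha> - mono 0 \<alpha> *\<^sub>R c \<alpha>) \<le> \<tau> * norm (mono h0 \<alpha> *\<^sub>R c \<alpha>)" for \<alpha>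
      proof (cases "\<forall>b\<in>Basis. \<alpha> b = 0")
        case True
        then show ?thesis using \<tau> by (simp add: mono_def)
      next
        case False
        then obtain b0 where b0: "b0 \<in> Basis" "\<alpha> b0 \<noteq> 0" by auto
        have z: "mono 0 \<alpha> = 0"
          unfolding mono_def using b0 by (intro prod_zero) (auto simp: zero_power)
        have "\<bar>mono h \<alpha>\<bar> \<le> (\<Prod>b\<in>Basis. \<tau> ^ \<alpha> b * s ^ \<alpha> b)"
          unfolding mono_def abs_prod power_abs
          by (intro prod_mono conjI)
             (auto simp: power_mult_distrib[symmetric] \<tau>(3)[symmetric] intro!: power_mono Basis_le_norm)
        also have "\<dots> = \<tau> ^ (\<Sum>b\<in>Basis. \<alpha> b) * mono h0 \<alpha>"
          by (simp add: prod.distrib power_sum mono_def h0b)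
        also have "\<dots> \<le> \<tau> * mono h0 \<alpha>"
        proof (rule mult_right_mono[OF _ mono_nn])
          have "\<alpha> b0 \<le> (\<Sum>b\<in>Basis. \<alpha> b)" using b0 by (intro member_le_sum) auto
          then have "1 \<le> (\<Sum>b\<in>Basis. \<alpha> b)" using b0 by linarith
          then show "\<tau> ^ (\<Sum>b\<in>Basis. \<alpha> b) \<le> \<tau>"
            using power_decreasing[of 1 "\<Sum>b\<in>Basis. \<alpha> b" \<tau>] \<tau> by simp
        qed
        finally have "\<bar>mono h \<alpha>\<bar> \<le> \<tau> * mono h0 \<alpha>" .
        then have "\<bar>mono h \<alpha>\<bar> * norm (c \<alpha>) \<le> (\<tau> * mono h0 \<alpha>) * norm (c \<alpha>)"
          by (rule mult_right_mono) simp
        then show ?thesis using mono_nn[of \<alpha>] by (simp add: z mult.assoc)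
      qed
      ultimately have "norm (f (p + h) - f (p + 0)) \<le> \<tau> * B"
        by (rule norm_infsum_le)
      then show ?thesis by (simp add: \<tau>_def)
    qed
    have "((\<lambda>h. norm h / s * B) \<longlongrightarrow> 0) (at 0)"
      using s by (auto intro!: tendsto_eq_intros)
    moreover have "eventually (\<lambda>h. norm (f (p + h) - f p) \<le> norm h / s * B) (at 0)"
      unfolding eventually_at using lip s by (intro exI[of _ s]) auto
    ultimately have "((\<lambda>h. f (p + h) - f p) \<longlongrightarrow> 0) (at 0)"
      by (rule Lim_null_comparison[rotated])
    then show ?thesis
      by (simp add: isCont_iff LIM_zero_iff)
  qed
  then show ?thesis by (simp add: continuous_at_imp_continuous_on)
qed

text \<open>The finite-dimensional theorem of Minty and Browder. If \<open>y\<close> were not attained, then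
\<open>x \<mapsto> - \<rho> (e x - y) / norm (e x - y)\<close> would map the ball of radius \<open>\<rho>\<close> continuously into its boundary
sphere. At a fixed point, which Brouwer's theorem provides, \<open>e x - y\<close> points against \<open>x\<close>. For large \<open>\<rho>\<close>,
strong monotonicity excludes this.\<close>

lemma strongly_monotone_surj:
  fixes e :: "'a::euclidean_space \<Rightarrow> 'a"
  assumes cont: "continuous_on UNIV e"
    and c: "c > 0"
    and mono: "\<And>x y. c * (norm (x - y))\<^sup>2 \<le> (x - y) \<bullet> (e x - e y)"
  shows "surj e"
proof -
  have "\<exists>x. e x = y" for y
  proof (rule ccontr)
    assume "\<nexists>x. e x = y"
    then have nz: "e x - y \<noteq> 0" for x by auto
    \<comment> \<open>On the sphere of this radius, \<open>c * \<rho>\<^sup>2\<close> exceeds \<open>\<rho> * norm (e 0 - y)\<close>.\<close>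
    define \<rho> where "\<rho> = (norm (e 0 - y) + 1) / c"
    have \<rho>: "\<rho> > 0" using c by (simp add: \<rho>_def add_nonneg_pos)
    define h where "h x = - (\<rho> / norm (e x - y)) *\<^sub>R (e x - y)" for x
    have nh: "norm (h x) = \<rho>" for x using nz[of x] \<rho> by (simp add: h_def)
    have "continuous_on (cball 0 \<rho>) h"
      unfolding h_def using nz
      by (intro continuous_intros continuous_on_subset[OF cont]) auto
    then obtain x where x: "x \<in> cball 0 \<rho>" "h x = x"
      using \<rho> nh by (elim brouwer_ball[rotated]) auto
    then have nx: "norm x = \<rho>" using nh[of x] by simp
    have "x \<bullet> (e x - y) = - (\<rho> * norm (e x - y))"
      using nz[of x] by (subst x(2)[symmetric]) (simp add: h_def dot_square_norm power2_eq_square)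
    then have "x \<bullet> (e x - y) < 0" using \<rho> nz[of x] by simp
    moreover have "x \<bullet> (e x - y) = (x - 0) \<bullet> (e x - e 0) + x \<bullet> (e 0 - y)"
      by (simp add: inner_diff_right)
    moreover have "\<bar>x \<bullet> (e 0 - y)\<bar> \<le> \<rho> * norm (e 0 - y)"
      using Cauchy_Schwarz_ineq2[of x "e 0 - y"] nx by simp
    moreover have "c * (norm (x - 0))\<^sup>2 \<le> (x - 0) \<bullet> (e x - e 0)" by (rule mono)
    moreover have "c * (norm (x - 0))\<^sup>2 = \<rho> * (norm (e 0 - y) + 1)"
      using nx c by (simp add: power2_eq_square \<rho>_def)
    ultimately show False using \<rho> by (simp add: distrib_left)
  qed
  then show ?thesis by (metis surjI)
qed

section \<open>The dissipation inequality bounds the simulation error\<close>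

lemma qnorm_add: "qnorm (A + B) v = qnorm A v + qnorm B v"
  by (simp add: qnorm_def matrix_vector_mult_add_rdistrib inner_add_right)

lemma qnorm_mat: "qnorm (mat c) v = c * (norm v)\<^sup>2"
proof -
  have "mat c *v v = c *\<^sub>R v"
    by (simp add: vec_eq_iff matrix_vector_mult_def mat_def if_distrib[of "\<lambda>u. u * _"] cong: if_cong)
  then show ?thesis by (simp add: qnorm_def dot_square_norm)
qed

lemma qnorm_gram: "qnorm (transpose C ** C) v = (norm (C *v v))\<^sup>2"
proof -
  have "qnorm (transpose C ** C) v = ((C *v v) v* C) \<bullet> v"
    by (simp add: qnorm_def inner_commute flip: matrix_vector_mul_assoc)
  then show ?thesis by (simp add: dot_lmul_matrix dot_square_norm)
qed

lemma qnorm_psd_nonneg: "psd S \<Longrightarrow> 0 \<le> qnorm S v"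
  by (simp add: psd_def qnorm_def)

lemma qnorm_zero [simp]: "qnorm S 0 = 0"
  by (simp add: qnorm_def)

text \<open>The sum-of-squares certificates act through the sign of their right-hand sides. The first inequality is the first identity as it stands; the second is the second
identity at \<open>q = 0\<close>, where the dynamics drop out.\<close>

lemma Theta_dissipation:
  fixes \<phi> :: "'k::finite \<Rightarrow> (real ^ 'x::finite) \<times> (real ^ 'w::finite) \<Rightarrow> real ^ 'x"
  assumes "(\<theta>, r) \<in> Theta C \<phi> \<psi> N \<delta> Pi_map" and "\<delta> > 0"
  obtains P where
    "\<And>\<xi> x w \<Delta> q. 0 \<le> r (\<xi> \<frown> x \<frown> w) + 2 * (\<Delta> \<bullet> (e_model \<psi> \<theta> (x + \<Delta>) - e_model \<psi> \<theta> x))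
        - qnorm P \<Delta> - (norm (C *v \<Delta>))\<^sup>2 + qnorm P q
        - 2 * (q \<bullet> (f_model \<phi> \<theta> (x + \<Delta>) w - e_model \<psi> \<theta> \<xi>))"
    "\<And>x \<Delta>. qnorm P \<Delta> \<le> 2 * (\<Delta> \<bullet> (e_model \<psi> \<theta> (x + \<Delta>) - e_model \<psi> \<theta> x))"
    "\<And>\<Delta>. \<delta> * (norm \<Delta>)\<^sup>2 \<le> qnorm P \<Delta>"
proof -
  from assms(1) obtain P S1 S2 \<epsilon> where P: "psd (P - mat \<delta>)" and S: "psd S1" "psd S2" and "\<epsilon> > 0"
    and 1: "\<And>\<xi> x w \<Delta> q. r (\<xi> \<frown> x \<frown> w) + 2 * (\<Delta> \<bullet> (e_model \<psi> \<theta> (x + \<Delta>) - e_model \<psi> \<theta> x))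
          - qnorm (P + transpose C ** C) \<Delta> + qnorm P q
          - 2 * (q \<bullet> (f_model \<phi> \<theta> (x + \<Delta>) w - e_model \<psi> \<theta> \<xi>))
        = qnorm S1 (Pi_map (\<xi> \<frown> x \<frown> w \<frown> \<Delta> \<frown> q))"
    and 2: "\<And>\<xi> x w \<Delta> q. 2 * (\<Delta> \<bullet> (e_model \<psi> \<theta> (x + \<Delta>) - e_model \<psi> \<theta> x))
          - qnorm (P + mat \<epsilon>) \<Delta> + qnorm P q
          - 2 * (q \<bullet> (f_model \<phi> \<theta> (x + \<Delta>) w - f_model \<phi> \<theta> x w))
        = qnorm S2 (Pi_map (\<xi> \<frown> x \<frown> w \<frown> \<Delta> \<frown> q))"
    unfolding Theta_def by auto
  show thesis
  proof
    fix \<xi> x \<Delta> q :: "real ^ 'x" and w :: "real ^ 'w"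
    show "0 \<le> r (\<xi> \<frown> x \<frown> w) + 2 * (\<Delta> \<bullet> (e_model \<psi> \<theta> (x + \<Delta>) - e_model \<psi> \<theta> x))
        - qnorm P \<Delta> - (norm (C *v \<Delta>))\<^sup>2 + qnorm P q
        - 2 * (q \<bullet> (f_model \<phi> \<theta> (x + \<Delta>) w - e_model \<psi> \<theta> \<xi>))"
      using 1[of \<xi> x w \<Delta> q] qnorm_psd_nonneg[OF S(1), of "Pi_map (\<xi> \<frown> x \<frown> w \<frown> \<Delta> \<frown> q)"]
      by (simp add: qnorm_add qnorm_gram)
    have "0 \<le> \<epsilon> * (norm \<Delta>)\<^sup>2" using \<open>\<epsilon> > 0\<close> by simp
    then show "qnorm P \<Delta> \<le> 2 * (\<Delta> \<bullet> (e_model \<psi> \<theta> (x + \<Delta>) - e_model \<psi> \<theta> x))"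
      using 2[where x = x and \<Delta> = \<Delta> and \<xi> = 0 and w = w and q = 0] qnorm_psd_nonneg[OF S(2), of "Pi_map (0 \<frown> x \<frown> w \<frown> \<Delta> \<frown> 0)"]
      by (simp add: qnorm_add qnorm_mat)
    have "qnorm P \<Delta> = qnorm (P - mat \<delta>) \<Delta> + qnorm (mat \<delta>) \<Delta>"
      by (simp flip: qnorm_add)
    then show "\<delta> * (norm \<Delta>)\<^sup>2 \<le> qnorm P \<Delta>"
      using qnorm_psd_nonneg[OF P, of \<Delta>] by (simp add: qnorm_mat)
  qed
qed

lemma e_model_surj:
  fixes \<phi> :: "'k::finite \<Rightarrow> (real ^ 'x::finite) \<times> (real ^ 'w::finite) \<Rightarrow> real ^ 'x"
  assumes "(\<theta>, r) \<in> Theta C \<phi> \<psi> N \<delta> Pi_map" and "\<delta> > 0"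
    and "\<And>i. real_analytic (\<psi> i)"
  shows "surj (e_model \<psi> \<theta>)"
proof -
  obtain P where P: "\<And>x \<Delta>. qnorm P \<Delta> \<le> 2 * (\<Delta> \<bullet> (e_model \<psi> \<theta> (x + \<Delta>) - e_model \<psi> \<theta> x))"
    "\<And>\<Delta>. \<delta> * (norm \<Delta>)\<^sup>2 \<le> qnorm P \<Delta>"
    using Theta_dissipation[OF assms(1,2)] by metis
  show ?thesis
  proof (rule strongly_monotone_surj[of _ "\<delta> / 2"])
    show "continuous_on UNIV (e_model \<psi> \<theta>)"
      unfolding e_model_def
      by (intro continuous_intros real_analytic_continuous assms(3))
    show "\<delta> / 2 * (norm (x - y))\<^sup>2 \<le> (x - y) \<bullet> (e_model \<psi> \<theta> x - e_model \<psi> \<theta> y)" for x y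
      using P(1)[of "x - y" y] P(2)[of "x - y"] by simp
  qed (use assms(2) in simp)
qed

text \<open>The storage function \<open>V t = 2 \<Delta>' (e (x + \<Delta>) - e x) - qnorm P \<Delta>\<close>, with \<open>\<Delta>\<close> the deviation of the
simulated state from the recorded state \<open>x = x t\<close>, is nonnegative and starts at 0. It satisfies
\<open>V (t + 1) + (norm (C \<Delta>))\<^sup>2 \<le> V t + r (z (t + 1))\<close>, with \<open>z (t + 1)\<close> the recorded regressor, so the sum over
time telescopes.\<close>

lemma simulation_error_le_sum:
  fixes \<phi> :: "'k::finite \<Rightarrow> (real ^ 'x::finite) \<times> (real ^ 'w::finite) \<Rightarrow> real ^ 'x"
  assumes Th: "(\<theta>, r) \<in> Theta C \<phi> \<psi> N \<delta> Pi_map" and "\<delta> > 0"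
    and an: "\<And>i. real_analytic (\<psi> i)"
  shows "J_SE C T (a_model \<phi> \<psi> \<theta>) (x 0) x w
    \<le> (1 / real T) * (\<Sum>t=1..T. r (x t \<frown> x (t - 1) \<frown> w t))"
proof -
  obtain P where
    diss: "\<And>\<xi> x w \<Delta> q. 0 \<le> r (\<xi> \<frown> x \<frown> w) + 2 * (\<Delta> \<bullet> (e_model \<psi> \<theta> (x + \<Delta>) - e_model \<psi> \<theta> x))
        - qnorm P \<Delta> - (norm (C *v \<Delta>))\<^sup>2 + qnorm P q
        - 2 * (q \<bullet> (f_model \<phi> \<theta> (x + \<Delta>) w - e_model \<psi> \<theta> \<xi>))"
    and nonneg: "\<And>x \<Delta>. qnorm P \<Delta> \<le> 2 * (\<Delta> \<bullet> (e_model \<psi> \<theta> (x + \<Delta>) - e_model \<psi> \<theta> x))"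
    using Theta_dissipation[OF Th \<open>\<delta> > 0\<close>] by metis
  define y where "y = G_sim (a_model \<phi> \<psi> \<theta>) (x 0) w"
  define V where "V t = 2 * ((y t - x t) \<bullet> (e_model \<psi> \<theta> (y t) - e_model \<psi> \<theta> (x t)))
    - qnorm P (y t - x t)" for t
  have ey: "e_model \<psi> \<theta> (y (Suc t)) = f_model \<phi> \<theta> (y t) (w (Suc t))" for t
    using e_model_surj[OF Th \<open>\<delta> > 0\<close> an] by (simp add: y_def a_model_def surj_f_inv_f)
  \<comment> \<open>In the first inequality, \<open>q\<close> is the deviation at the next time: this choice turns the terms in \<open>q\<close> into \<open>- V (t + 1)\<close>.\<close>
  have step: "V (Suc t) + (norm (C *v (x t - y t)))\<^sup>2 \<le> V t + r (x (Suc t) \<frown> x t \<frown> w (Suc t))" for t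
  proof -
    have "C *v (x t - y t) = - (C *v (y t - x t))"
      by (simp add: matrix_vector_mult_diff_distrib)
    then show ?thesis
      using diss[of "x (Suc t)" "x t" "w (Suc t)" "y t - x t" "y (Suc t) - x (Suc t)"]
      by (simp add: V_def flip: ey)
  qed
  have "V T + (\<Sum>t<T. (norm (C *v (x t - y t)))\<^sup>2)
    \<le> V 0 + (\<Sum>t<T. r (x (Suc t) \<frown> x t \<frown> w (Suc t)))"
  proof (induction T)
    case (Suc T)
    then show ?case using step[of T] by simp
  qed simp
  moreover have "V 0 = 0" by (simp add: V_def y_def)
  moreover have "V T \<ge> 0" using nonneg[of "y T - x T" "x T"] by (simp add: V_def)
  moreover have "(\<Sum>t=1..T. r (x t \<frown> x (t - 1) \<frown> w t))
      = (\<Sum>t<T. r (x (Suc t) \<frown> x t \<frown> w (Suc t)))"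
    by (rule sum.reindex_bij_witness[of _ Suc "\<lambda>t. t - 1"]) auto
  ultimately have "(\<Sum>t<T. (norm (C *v (x t - y t)))\<^sup>2) \<le> (\<Sum>t=1..T. r (x t \<frown> x (t - 1) \<frown> w t))"
    by linarith
  then show ?thesis
    unfolding J_SE_def y_def by (intro mult_left_mono) auto
qed

text \<open>Why moments suffice: if \<open>R\<close> is a Gram matrix of \<open>r\<close>, the trace objective is the empirical average of \<open>r\<close>.\<close>

lemma tr_mult_M_bar:
  assumes "\<And>z. r z = (\<Sum>\<alpha>\<in>aleph N. \<Sum>\<beta>\<in>aleph N. R \<alpha> \<beta> * vpow z (\<alpha> + \<beta>))"
  shows "tr_mult (aleph N) R (M_bar N T w x)
    = (1 / real N) * (\<Sum>i=1..N. (1 / real T) * (\<Sum>t=1..T. r (x i t \<frown> x i (t - 1) \<frown> w t)))"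
proof -
  let ?I = "aleph N" and ?z = "\<lambda>i t. x i t \<frown> x i (t - 1) \<frown> w t"
  have "tr_mult ?I R (M_bar N T w x)
    = (\<Sum>\<alpha>\<in>?I. \<Sum>\<beta>\<in>?I. \<Sum>i=1..N. \<Sum>t=1..T. (1 / real N) * ((1 / real T) * (R \<alpha> \<beta> * vpow (?z i t) (\<alpha> + \<beta>))))"
    by (simp add: tr_mult_def M_bar_def mk_mat_def moment_def sum_distrib_left add.commute mult_ac)
  also have "\<dots> = (\<Sum>\<alpha>\<in>?I. \<Sum>i=1..N. \<Sum>\<beta>\<in>?I. \<Sum>t=1..T. (1 / real N) * ((1 / real T) * (R \<alpha> \<beta> * vpow (?z i t) (\<alpha> + \<beta>))))"
    by (intro sum.cong refl sum.swap)
  also have "\<dots> = (\<Sum>i=1..N. \<Sum>\<alpha>\<in>?I. \<Sum>\<beta>\<in>?I. \<Sum>t=1..T. (1 / real N) * ((1 / real T) * (R \<alpha> \<beta> * vpow (?z i t) (\<alpha> + \<beta>))))"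
    by (rule sum.swap)
  also have "\<dots> = (\<Sum>i=1..N. \<Sum>\<alpha>\<in>?I. \<Sum>t=1..T. \<Sum>\<beta>\<in>?I. (1 / real N) * ((1 / real T) * (R \<alpha> \<beta> * vpow (?z i t) (\<alpha> + \<beta>))))"
    by (intro sum.cong refl sum.swap)
  also have "\<dots> = (\<Sum>i=1..N. \<Sum>t=1..T. \<Sum>\<alpha>\<in>?I. \<Sum>\<beta>\<in>?I. (1 / real N) * ((1 / real T) * (R \<alpha> \<beta> * vpow (?z i t) (\<alpha> + \<beta>))))"
    by (intro sum.cong refl sum.swap)
  also have "\<dots> = (1 / real N) * (\<Sum>i=1..N. (1 / real T) * (\<Sum>t=1..T. r (?z i t)))"
    by (simp only: sum_distrib_left assms)
  finally show ?thesis .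
qed

section \<open>Projection onto the positive semidefinite cone\<close>

lemma finite_mdeg_le: "finite {\<alpha> :: nat ^ 'n::finite. mdeg \<alpha> \<le> N}"
proof (rule finite_subset)
  show "{\<alpha> :: nat ^ 'n. mdeg \<alpha> \<le> N} \<subseteq> vec_lambda ` (UNIV \<rightarrow>\<^sub>E {..N})"
  proof
    fix \<alpha> :: "nat ^ 'n" assume "\<alpha> \<in> {\<alpha>. mdeg \<alpha> \<le> N}"
    then have "\<alpha> $ d \<le> N" for d
      using member_le_sum[of d UNIV "\<lambda>d. \<alpha> $ d"] by (auto simp: mdeg_def)
    then show "\<alpha> \<in> vec_lambda ` (UNIV \<rightarrow>\<^sub>E {..N})"
      by (intro image_eqI[of _ _ "vec_nth \<alpha>"]) (auto simp: vec_nth_inverse)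
  qed
qed (intro finite_imageI finite_PiE; simp)

lemma finite_aleph: "finite (aleph N :: (nat ^ 'n::finite) set)"
  by (rule finite_subset[OF _ finite_mdeg_le[of N]]) (auto simp: aleph_def)

lemma frob_L2_set: "frob I A = L2_set (\<lambda>(i, j). A i j) (I \<times> I)"
  by (simp add: frob_def L2_set_def sum.cartesian_product split_beta)

lemma frob_triangle: "frob I (\<lambda>i j. A i j - B i j) \<le> frob I (\<lambda>i j. D i j - A i j) + frob I (\<lambda>i j. D i j - B i j)"
proof -
  have "frob I (\<lambda>i j. A i j - B i j)
    = L2_set (\<lambda>p. (case p of (i, j) \<Rightarrow> A i j - D i j) + (case p of (i, j) \<Rightarrow> D i j - B i j)) (I \<times> I)"
    unfolding frob_L2_set by (rule L2_set_cong) auto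
  also have "\<dots> \<le> frob I (\<lambda>i j. A i j - D i j) + frob I (\<lambda>i j. D i j - B i j)"
    unfolding frob_L2_set by (rule L2_set_triangle_ineq)
  also have "frob I (\<lambda>i j. A i j - D i j) = frob I (\<lambda>i j. D i j - A i j)"
    by (simp add: frob_def power2_commute)
  finally show ?thesis .
qed

lemma frob_nonneg [simp]: "0 \<le> frob I A"
  by (simp add: frob_L2_set)

lemma entry_le_frob:
  assumes "finite I" "i \<in> I" "j \<in> I"
  shows "\<bar>A i j\<bar> \<le> frob I A"
proof -
  have "\<bar>case (i, j) of (i, j) \<Rightarrow> \<bar>A i j\<bar>\<bar> \<le> L2_set (\<lambda>(i, j). \<bar>A i j\<bar>) (I \<times> I)"
    using member_le_L2_set[of "I \<times> I" "(i, j)" "\<lambda>(i, j). \<bar>A i j\<bar>"] assms by simp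
  then show ?thesis by (simp add: frob_def L2_set_def sum.cartesian_product split_beta)
qed

lemma frob_le_entries:
  fixes \<eta> :: real
  assumes "finite I" "\<And>i j. i \<in> I \<Longrightarrow> j \<in> I \<Longrightarrow> \<bar>A i j\<bar> \<le> \<eta>"
  shows "frob I A \<le> (card I)\<^sup>2 * \<eta>"
proof -
  have "frob I A \<le> (\<Sum>p\<in>I \<times> I. \<bar>case p of (i, j) \<Rightarrow> A i j\<bar>)"
    unfolding frob_L2_set by (rule L2_set_le_sum_abs)
  also have "\<dots> \<le> (\<Sum>p\<in>I \<times> I. \<eta>)"
    using assms(2) by (intro sum_mono) auto
  finally show ?thesis by (simp add: card_cartesian_product power2_eq_square)
qed

lemma abs_tr_mult_le:
  "\<bar>tr_mult I R B\<bar> \<le> frob I R * frob I B"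
proof -
  have "\<bar>tr_mult I R B\<bar> \<le> (\<Sum>p\<in>I \<times> I. \<bar>case p of (i, j) \<Rightarrow> R i j\<bar> * \<bar>case p of (i, j) \<Rightarrow> B j i\<bar>)"
    unfolding tr_mult_def sum.cartesian_product
    by (rule order_trans[OF sum_abs]) (simp add: split_beta abs_mult)
  also have "\<dots> \<le> frob I R * frob I (\<lambda>i j. B j i)"
    unfolding frob_L2_set by (rule L2_set_mult_ineq)
  also have "frob I (\<lambda>i j. B j i) = frob I B"
    unfolding frob_def by (subst sum.swap) simp
  finally show ?thesis .
qed

lemma tr_mult_diff_right: "tr_mult I R (\<lambda>i j. A i j - B i j) = tr_mult I R A - tr_mult I R B"
  by (simp add: tr_mult_def right_diff_distrib sum_subtractf)

lemma continuous_on_entry: "continuous_on UNIV (\<lambda>A :: 'i \<Rightarrow> 'j \<Rightarrow> real. A i j)"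
  by (rule continuous_on_product_then_coordinatewise[OF continuous_on_product_coordinates])

text \<open>Tychonoff's theorem, for the product topology that the function type carries. Matrices are functions
here, so this replaces the Heine-Borel theorem in the existence proof for the projection.\<close>

lemma compact_UNIV_fun:
  fixes S :: "'i \<Rightarrow> 'b::topological_space set"
  assumes "\<And>i. compact (S i)"
  shows "compact {f. \<forall>i. f i \<in> S i}"
proof -
  have "compactin (product_topology (\<lambda>i. euclidean) UNIV) (PiE UNIV S)"
    using assms by (simp add: compactin_PiE)
  moreover have "PiE UNIV S = {f. \<forall>i. f i \<in> S i}" by (auto simp: PiE_def Pi_def)
  ultimately show ?thesis by (simp add: euclidean_product_topology)
qed

lemma closed_mats_psd: "closed (mats_psd I)"
proof -
  have "mats_psd I = (\<Inter>i. \<Inter>j. {A. i \<notin> I \<or> j \<notin> I \<longrightarrow> A i j = 0}) \<inter> (\<Inter>i. \<Inter>j. {A. A i j = A j i})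
      \<inter> (\<Inter>u. {A. 0 \<le> (\<Sum>i\<in>I. \<Sum>j\<in>I. u i * A i j * u j)})"
    by (auto simp: mats_psd_def mats_sym_def mats_def)
  moreover have "closed {A :: 'a \<Rightarrow> 'a \<Rightarrow> real. i \<notin> I \<or> j \<notin> I \<longrightarrow> A i j = 0}" for i j
    by (cases "i \<notin> I \<or> j \<notin> I") (auto intro!: closed_Collect_eq continuous_on_entry continuous_on_const)
  ultimately show ?thesis
    by (auto intro!: closed_Int closed_INT closed_Collect_eq closed_Collect_le
        continuous_on_entry continuous_intros)
qed

text \<open>The infimum of the distance is attained, so that the choice in \<^const>\<open>psd_proj\<close> is meaningful: matrices
at least as close to \<open>A\<close> as 0 is lie in a compact box, and the cone is closed.\<close>

lemma psd_proj_minimal: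
  assumes "finite I" and B: "B \<in> mats_psd I"
  shows "frob I (\<lambda>i j. A i j - psd_proj I A i j) \<le> frob I (\<lambda>i j. A i j - B i j)"
proof -
  let ?d = "\<lambda>B. frob I (\<lambda>i j. A i j - B i j)"
  define K where "K i j = \<bar>A i j\<bar> + ?d (\<lambda>_ _. 0)" for i j
  let ?box = "{B :: 'a \<Rightarrow> 'a \<Rightarrow> real. \<forall>i. B i \<in> {b. \<forall>j. b j \<in> {- K i j..K i j}}}"
  let ?S = "mats_psd I \<inter> ?box"
  have "0 \<le> K i j" for i j by (simp add: K_def add_nonneg_nonneg)
  then have zero: "(\<lambda>_ _. 0) \<in> ?S"
    by (auto simp: mats_psd_def mats_sym_def mats_def)
  have "compact ?S"
    by (intro closed_Int_compact closed_mats_psd compact_UNIV_fun) simp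
  moreover have "continuous_on ?S ?d"
    unfolding frob_def
    by (intro continuous_intros continuous_on_subset[OF continuous_on_entry]) auto
  ultimately obtain B0 where B0: "B0 \<in> ?S" "\<And>B. B \<in> ?S \<Longrightarrow> ?d B0 \<le> ?d B"
    using continuous_attains_inf[of ?S ?d] zero by blast
  have all: "?d B0 \<le> ?d B" if B: "B \<in> mats_psd I" for B
  proof (cases "?d B \<le> ?d (\<lambda>_ _. 0)")
    case True
    have "\<bar>B i j\<bar> \<le> K i j" for i j
    proof (cases "i \<in> I \<and> j \<in> I")
      case True
      then have "\<bar>A i j - B i j\<bar> \<le> ?d B"
        using entry_le_frob[of I i j "\<lambda>i j. A i j - B i j"] \<open>finite I\<close> by simp
      then show ?thesis using \<open>?d B \<le> ?d (\<lambda>_ _. 0)\<close> by (simp add: K_def)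
    next
      case False
      then have "B i j = 0" using B by (auto simp: mats_psd_def mats_sym_def mats_def)
      then show ?thesis by (simp add: K_def add_nonneg_nonneg)
    qed
    then have "B \<in> ?S" using B by (auto simp: abs_le_iff minus_le_iff)
    then show ?thesis by (rule B0)
  next
    case False
    then show ?thesis using B0(2)[OF zero] by linarith
  qed
  have "is_arg_min ?d (\<lambda>B. B \<in> mats_psd I) B0"
    using B0(1) all by (auto simp: is_arg_min_linorder)
  then have "is_arg_min ?d (\<lambda>B. B \<in> mats_psd I) (psd_proj I A)"
    unfolding psd_proj_def arg_min_on_def arg_min_def
    by (rule someI[where P = "is_arg_min ?d (\<lambda>B. B \<in> mats_psd I)"])
  then show ?thesis using B by (simp add: is_arg_min_linorder)
qed

text \<open>A weak form of nonexpansiveness. The factor 2 is the price for using only the triangle inequality and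
minimality instead of convexity of the cone.\<close>

lemma psd_proj_close:
  assumes "finite I" and "B \<in> mats_psd I"
  shows "frob I (\<lambda>i j. psd_proj I A i j - B i j) \<le> 2 * frob I (\<lambda>i j. A i j - B i j)"
  using frob_triangle[of I "psd_proj I A" B A] psd_proj_minimal[OF assms, of A] by linarith

lemma vpow_add: "vpow z (\<alpha> + \<beta>) = vpow z \<alpha> * vpow z \<beta>"
  by (simp add: vpow_def power_add prod.distrib)

text \<open>Each regressor \<open>z\<close> contributes the rank-one form \<open>u \<mapsto> (\<Sum>\<alpha>. u \<alpha> * vpow z \<alpha>)\<^sup>2\<close>.\<close>

lemma M_bar_psd:
  fixes w :: "nat \<Rightarrow> real ^ 'w::finite" and x :: "nat \<Rightarrow> nat \<Rightarrow> real ^ 'x::finite"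
  shows "M_bar N T w x \<in> mats_psd (aleph N)"
proof -
  let ?I = "aleph N :: (nat ^ ('x + 'x + 'w)) set" and ?z = "\<lambda>i t. x i t \<frown> x i (t - 1) \<frown> w t"
  have "0 \<le> (\<Sum>\<alpha>\<in>?I. \<Sum>\<beta>\<in>?I. u \<alpha> * M_bar N T w x \<alpha> \<beta> * u \<beta>)" for u
  proof -
    have "(\<Sum>\<alpha>\<in>?I. \<Sum>\<beta>\<in>?I. u \<alpha> * M_bar N T w x \<alpha> \<beta> * u \<beta>)
      = (\<Sum>\<alpha>\<in>?I. \<Sum>\<beta>\<in>?I. \<Sum>i=1..N. \<Sum>t=1..T.
          (1 / real N) * ((1 / real T) * ((u \<alpha> * vpow (?z i t) \<alpha>) * (u \<beta> * vpow (?z i t) \<beta>))))"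
      by (simp add: M_bar_def mk_mat_def moment_def vpow_add sum_distrib_left sum_distrib_right mult_ac)
    also have "\<dots> = (\<Sum>i=1..N. \<Sum>t=1..T. \<Sum>\<alpha>\<in>?I. \<Sum>\<beta>\<in>?I.
          (1 / real N) * ((1 / real T) * ((u \<alpha> * vpow (?z i t) \<alpha>) * (u \<beta> * vpow (?z i t) \<beta>))))"
      by (subst sum.swap, subst (2) sum.swap, subst (3) sum.swap, subst (4) sum.swap) (rule refl)
    also have "\<dots> = (\<Sum>i=1..N. \<Sum>t=1..T. (1 / real N) * ((1 / real T) * (\<Sum>\<alpha>\<in>?I. u \<alpha> * vpow (?z i t) \<alpha>)\<^sup>2))"
      by (simp only: power2_eq_square sum_product) (simp only: sum_distrib_left)
    also have "\<dots> \<ge> 0" by (intro sum_nonneg mult_nonneg_nonneg) auto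
    finally show ?thesis .
  qed
  then show ?thesis
    by (auto simp: mats_psd_def mats_sym_def mats_def M_bar_def mk_mat_def add.commute)
qed

section \<open>Monomials as products over experiments\<close>

lemma bij_coord: "bij_betw (coord :: nat \<Rightarrow> 'n::enum) {1..CARD('n)} UNIV"
proof -
  let ?e = "enum_class.enum :: 'n list"
  have dist: "distinct ?e" by (rule enum_distinct)
  have len: "length ?e = CARD('n)"
    using distinct_card[OF dist] by (simp add: enum_UNIV)
  have "bij_betw (\<lambda>d. d - 1) {1..CARD('n)} {..<CARD('n)}"
    by (rule bij_betw_byWitness[where f' = Suc]) auto
  moreover have "bij_betw ((!) ?e) {..<CARD('n)} UNIV"
    using bij_betw_nth[OF dist, of "{..<CARD('n)}" UNIV] len by (simp add: enum_UNIV)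
  ultimately have "bij_betw ((!) ?e \<circ> (\<lambda>d. d - 1)) {1..CARD('n)} UNIV"
    by (rule bij_betw_trans)
  then show ?thesis by (simp add: coord_def[abs_def] comp_def)
qed

lemma beta_eq:
  fixes \<alpha> :: "nat ^ 'n::enum"
  assumes "m < CARD('n)" "(\<Sum>j=1..m. \<alpha> $ coord j) < i" "i \<le> (\<Sum>j=1..Suc m. \<alpha> $ coord j)"
  shows "beta \<alpha> i = Suc m"
  unfolding beta_def
proof (rule Min_eqI)
  fix d assume d: "d \<in> {d \<in> {1..CARD('n)}. i \<le> (\<Sum>j=1..d. \<alpha> $ coord j)}"
  show "Suc m \<le> d"
  proof (rule ccontr)
    assume "\<not> Suc m \<le> d"
    then have "(\<Sum>j=1..d. \<alpha> $ coord j) \<le> (\<Sum>j=1..m. \<alpha> $ coord j)"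
      by (intro sum_mono2) auto
    then show False using d assms by simp
  qed
qed (use assms in auto)

text \<open>The map \<open>beta \<alpha>\<close> lists coordinate \<open>d\<close> exactly \<open>[\<alpha>]\<^sub>d\<close> times, in increasing order of \<open>d\<close>. Hence the linearized
moment is an ordinary moment whenever all experiments record the same signal.\<close>

lemma prod_beta_eq_vpow:
  fixes \<alpha> :: "nat ^ 'n::enum"
  shows "(\<Prod>i=1..mdeg \<alpha>. z $ coord (beta \<alpha> i)) = vpow z \<alpha>"
proof -
  let ?s = "\<lambda>m. \<Sum>j=1..m. \<alpha> $ coord j"
  have "(\<Prod>i=1..?s m. z $ coord (beta \<alpha> i)) = (\<Prod>d=1..m. (z $ coord d) ^ (\<alpha> $ coord d))"
    if "m \<le> CARD('n)" for m
    using that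
  proof (induction m)
    case (Suc m)
    have "{1..?s (Suc m)} = {1..?s m} \<union> {?s m<..?s (Suc m)}" by auto
    then have "(\<Prod>i=1..?s (Suc m). z $ coord (beta \<alpha> i))
      = (\<Prod>i=1..?s m. z $ coord (beta \<alpha> i)) * (\<Prod>i\<in>{?s m<..?s (Suc m)}. z $ coord (beta \<alpha> i))"
      by (simp only:) (rule prod.union_disjoint; auto)
    also have "(\<Prod>i\<in>{?s m<..?s (Suc m)}. z $ coord (beta \<alpha> i))
      = (\<Prod>i\<in>{?s m<..?s (Suc m)}. z $ coord (Suc m))"
      using Suc.prems by (intro prod.cong refl arg_cong[where f = "\<lambda>d. z $ coord d"] beta_eq) auto
    finally show ?case using Suc by simp
  qed simp
  moreover have "?s CARD('n) = mdeg \<alpha>"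
    unfolding mdeg_def by (rule sum.reindex_bij_betw[OF bij_coord])
  moreover have "(\<Prod>d=1..CARD('n). (z $ coord d) ^ (\<alpha> $ coord d)) = vpow z \<alpha>"
    unfolding vpow_def by (rule prod.reindex_bij_betw[OF bij_coord])
  ultimately show ?thesis by (metis order_refl)
qed

section \<open>Convergence to zero in mean square\<close>

definition null_in_mean_square :: "'s measure \<Rightarrow> (nat \<Rightarrow> 's \<Rightarrow> real) \<Rightarrow> bool"
  where "null_in_mean_square M X \<longleftrightarrow>
    (\<forall>T. X T \<in> borel_measurable M \<and> integrable M (\<lambda>\<omega>. (X T \<omega>)\<^sup>2)) \<and>
    (\<lambda>T. \<integral>\<omega>. (X T \<omega>)\<^sup>2 \<partial>M) \<longlonglongrightarrow> 0"

lemma null_in_mean_square_add: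
  assumes X: "null_in_mean_square M X" and Y: "null_in_mean_square M Y"
  shows "null_in_mean_square M (\<lambda>T \<omega>. X T \<omega> + Y T \<omega>)"
proof -
  have [measurable]: "X T \<in> borel_measurable M" "Y T \<in> borel_measurable M" for T
    using X Y by (auto simp: null_in_mean_square_def)
  have int: "integrable M (\<lambda>\<omega>. 2 * (X T \<omega>)\<^sup>2 + 2 * (Y T \<omega>)\<^sup>2)" for T
    using X Y by (auto simp: null_in_mean_square_def)
  have le: "(a + b)\<^sup>2 \<le> 2 * a\<^sup>2 + 2 * b\<^sup>2" for a b :: real
    using zero_le_power2[of "a - b"] by (simp add: power2_eq_square algebra_simps)
  have int': "integrable M (\<lambda>\<omega>. (X T \<omega> + Y T \<omega>)\<^sup>2)" for T
    by (rule Bochner_Integration.integrable_bound[OF int[of T]]) (simp_all add: le)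
  have "(\<lambda>T. \<integral>\<omega>. (X T \<omega> + Y T \<omega>)\<^sup>2 \<partial>M) \<longlonglongrightarrow> 0"
  proof (rule tendsto_sandwich)
    show "eventually (\<lambda>T. 0 \<le> (\<integral>\<omega>. (X T \<omega> + Y T \<omega>)\<^sup>2 \<partial>M)) sequentially" by simp
    have "(\<integral>\<omega>. (X T \<omega> + Y T \<omega>)\<^sup>2 \<partial>M) \<le> (\<integral>\<omega>. 2 * (X T \<omega>)\<^sup>2 + 2 * (Y T \<omega>)\<^sup>2 \<partial>M)" for T
      by (rule integral_mono[OF int' int]) (rule le)
    also have "(\<integral>\<omega>. 2 * (X T \<omega>)\<^sup>2 + 2 * (Y T \<omega>)\<^sup>2 \<partial>M)
      = 2 * (\<integral>\<omega>. (X T \<omega>)\<^sup>2 \<partial>M) + 2 * (\<integral>\<omega>. (Y T \<omega>)\<^sup>2 \<partial>M)" for T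
      using X Y by (simp add: null_in_mean_square_def)
    finally show "eventually (\<lambda>T. (\<integral>\<omega>. (X T \<omega> + Y T \<omega>)\<^sup>2 \<partial>M)
      \<le> 2 * (\<integral>\<omega>. (X T \<omega>)\<^sup>2 \<partial>M) + 2 * (\<integral>\<omega>. (Y T \<omega>)\<^sup>2 \<partial>M)) sequentially" by simp
    show "(\<lambda>T. 2 * (\<integral>\<omega>. (X T \<omega>)\<^sup>2 \<partial>M) + 2 * (\<integral>\<omega>. (Y T \<omega>)\<^sup>2 \<partial>M)) \<longlonglongrightarrow> 0"
      using X Y by (auto simp: null_in_mean_square_def intro!: tendsto_eq_intros)
  qed simp
  with int' show ?thesis by (simp add: null_in_mean_square_def)
qed

lemma null_in_mean_square_sum:
  assumes "\<And>i. i \<in> I \<Longrightarrow> null_in_mean_square M (X i)"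
  shows "null_in_mean_square M (\<lambda>T \<omega>. \<Sum>i\<in>I. X i T \<omega>)"
  using assms
proof (induction I rule: infinite_finite_induct)
  case (insert i I)
  then show ?case
    using null_in_mean_square_add[of M "X i" "\<lambda>T \<omega>. \<Sum>i\<in>I. X i T \<omega>"] by simp
qed (simp_all add: null_in_mean_square_def)

lemma null_in_mean_square_cmult:
  assumes "null_in_mean_square M X"
  shows "null_in_mean_square M (\<lambda>T \<omega>. c * X T \<omega>)"
  using assms by (auto simp: null_in_mean_square_def power_mult_distrib
      intro!: tendsto_mult_right_zero borel_measurable_times)

context prob_space
begin

lemma null_in_mean_square_bounded:
  assumes [measurable]: "\<And>T. X T \<in> borel_measurable M"
    and bound: "\<And>T. AE \<omega> in M. \<bar>X T \<omega>\<bar> \<le> b T"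
    and b: "b \<longlonglongrightarrow> 0"
  shows "null_in_mean_square M X"
proof -
  have sq: "AE \<omega> in M. (X T \<omega>)\<^sup>2 \<le> (b T)\<^sup>2" for T
    using bound[of T] by eventually_elim (simp add: abs_le_square_iff[symmetric])
  have int: "integrable M (\<lambda>\<omega>. (X T \<omega>)\<^sup>2)" for T
    by (rule integrable_const_bound[of _ "(b T)\<^sup>2"]) (use sq[of T] in auto)
  have "(\<lambda>T. \<integral>\<omega>. (X T \<omega>)\<^sup>2 \<partial>M) \<longlonglongrightarrow> 0"
  proof (rule tendsto_sandwich)
    show "eventually (\<lambda>T. 0 \<le> (\<integral>\<omega>. (X T \<omega>)\<^sup>2 \<partial>M)) sequentially" by simp
    have "(\<integral>\<omega>. (X T \<omega>)\<^sup>2 \<partial>M) \<le> (b T)\<^sup>2" for T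
      by (rule integral_le_const[OF int sq])
    then show "eventually (\<lambda>T. (\<integral>\<omega>. (X T \<omega>)\<^sup>2 \<partial>M) \<le> (b T)\<^sup>2) sequentially" by simp
    show "(\<lambda>T. (b T)\<^sup>2) \<longlonglongrightarrow> 0" using b by (auto intro!: tendsto_eq_intros)
  qed simp
  with int show ?thesis by (simp add: null_in_mean_square_def)
qed

text \<open>The weak law of large numbers in its \<open>L\<^sup>2\<close> form: of the \<open>T\<^sup>2\<close> products in the expanded square only the \<open>T\<close>
diagonal ones contribute, so the mean square is \<open>O(1/T)\<close>.\<close>

lemma null_in_mean_square_average:
  assumes [measurable]: "\<And>t. X t \<in> borel_measurable M"
    and bound: "\<And>t. t \<ge> 1 \<Longrightarrow> AE \<omega> in M. \<bar>X t \<omega>\<bar> \<le> K"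
    and orth: "\<And>s t. s \<ge> 1 \<Longrightarrow> t \<ge> 1 \<Longrightarrow> s \<noteq> t \<Longrightarrow> expectation (\<lambda>\<omega>. X s \<omega> * X t \<omega>) = 0"
  shows "null_in_mean_square M (\<lambda>T \<omega>. (1 / real T) * (\<Sum>t=1..T. X t \<omega>))"
proof -
  have prod: "AE \<omega> in M. \<bar>X s \<omega> * X t \<omega>\<bar> \<le> K * K" if "s \<ge> 1" "t \<ge> 1" for s t
    using bound[OF that(1)] bound[OF that(2)]
  proof eventually_elim
    case (elim \<omega>)
    then show ?case using abs_ge_zero[of "X s \<omega>"] unfolding abs_mult by (intro mult_mono) linarith+
  qed
  have int: "integrable M (\<lambda>\<omega>. X s \<omega> * X t \<omega>)" if "s \<ge> 1" "t \<ge> 1" for s t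
    by (rule integrable_const_bound[of _ "K * K"]) (use prod[OF that] in auto)
  have sq: "((1 / real T) * (\<Sum>t=1..T. X t \<omega>))\<^sup>2
    = (1 / (real T)\<^sup>2) * (\<Sum>s=1..T. \<Sum>t=1..T. X s \<omega> * X t \<omega>)" for T \<omega>
    by (simp add: power_mult_distrib power_divide power2_eq_square sum_product)
  have int': "integrable M (\<lambda>\<omega>. ((1 / real T) * (\<Sum>t=1..T. X t \<omega>))\<^sup>2)" for T
    unfolding sq using int
    by (intro integrable_mult_right Bochner_Integration.integrable_sum) auto
  have le: "expectation (\<lambda>\<omega>. ((1 / real T) * (\<Sum>t=1..T. X t \<omega>))\<^sup>2) \<le> K * K / real T" for T
  proof -
    have "expectation (\<lambda>\<omega>. ((1 / real T) * (\<Sum>t=1..T. X t \<omega>))\<^sup>2)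
      = (1 / (real T)\<^sup>2) * (\<Sum>s=1..T. \<Sum>t=1..T. expectation (\<lambda>\<omega>. X s \<omega> * X t \<omega>))"
    proof -
      have "expectation (\<lambda>\<omega>. \<Sum>s=1..T. \<Sum>t=1..T. X s \<omega> * X t \<omega>)
        = (\<Sum>s=1..T. expectation (\<lambda>\<omega>. \<Sum>t=1..T. X s \<omega> * X t \<omega>))"
        by (intro Bochner_Integration.integral_sum Bochner_Integration.integrable_sum int)
          (auto simp only: atLeastAtMost_iff)
      also have "\<dots> = (\<Sum>s=1..T. \<Sum>t=1..T. expectation (\<lambda>\<omega>. X s \<omega> * X t \<omega>))"
        by (intro sum.cong refl Bochner_Integration.integral_sum int) (auto simp only: atLeastAtMost_iff)
      finally show ?thesis unfolding sq by (simp only: integral_mult_right_zero)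
    qed
    also have "(\<Sum>s=1..T. \<Sum>t=1..T. expectation (\<lambda>\<omega>. X s \<omega> * X t \<omega>))
      = (\<Sum>s=1..T. \<Sum>t=1..T. if s = t then expectation (\<lambda>\<omega>. X s \<omega> * X s \<omega>) else 0)"
      using orth by (intro sum.cong refl) auto
    also have "\<dots> = (\<Sum>s=1..T. expectation (\<lambda>\<omega>. X s \<omega> * X s \<omega>))"
      by simp
    also have "\<dots> \<le> (\<Sum>s=1..T. K * K)"
    proof (rule sum_mono)
      fix s assume "s \<in> {1..T}"
      then have s: "s \<ge> 1" by simp
      have "AE \<omega> in M. X s \<omega> * X s \<omega> \<le> K * K"
        using prod[OF s s] by eventually_elim simp
      then show "expectation (\<lambda>\<omega>. X s \<omega> * X s \<omega>) \<le> K * K"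
        by (rule integral_le_const[OF int[OF s s]])
    qed
    finally have "expectation (\<lambda>\<omega>. ((1 / real T) * (\<Sum>t=1..T. X t \<omega>))\<^sup>2) \<le> (1 / (real T)\<^sup>2) * (T * (K * K))"
      by (simp add: divide_right_mono)
    then show ?thesis by (cases "T = 0") (auto simp: power2_eq_square)
  qed
  have "(\<lambda>T. expectation (\<lambda>\<omega>. ((1 / real T) * (\<Sum>t=1..T. X t \<omega>))\<^sup>2)) \<longlonglongrightarrow> 0"
  proof (rule tendsto_sandwich[of "\<lambda>_. 0"])
    show "(\<lambda>T. K * K / real T) \<longlonglongrightarrow> 0" by (rule lim_const_over_n)
  qed (use le in auto)
  moreover have "(\<lambda>\<omega>. (1 / real T) * (\<Sum>t=1..T. X t \<omega>)) \<in> borel_measurable M" for T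
    by measurable
  ultimately show ?thesis unfolding null_in_mean_square_def using int' by blast
qed

lemma null_in_mean_square_prob:
  assumes X: "null_in_mean_square M X" and "\<eta> > 0"
  shows "(\<lambda>T. prob {\<omega>\<in>space M. \<eta> \<le> \<bar>X T \<omega>\<bar>}) \<longlonglongrightarrow> 0"
proof (rule tendsto_sandwich[of "\<lambda>_. 0"])
  have int: "integrable M (\<lambda>\<omega>. (X T \<omega>)\<^sup>2)" for T
    using X by (simp add: null_in_mean_square_def)
  have iff: "\<eta> \<le> \<bar>y\<bar> \<longleftrightarrow> \<eta>\<^sup>2 \<le> y\<^sup>2" for y
    by (subst abs_le_square_iff[symmetric]) (simp add: less_imp_le[OF \<open>\<eta> > 0\<close>])
  have le: "prob {\<omega>\<in>space M. \<eta> \<le> \<bar>X T \<omega>\<bar>} \<le> expectation (\<lambda>\<omega>. (X T \<omega>)\<^sup>2) / \<eta>\<^sup>2" for T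
    unfolding iff
    by (rule integral_Markov_inequality_measure[where A = "{}", OF int]) (use \<open>\<eta> > 0\<close> in auto)
  show "eventually (\<lambda>T. prob {\<omega>\<in>space M. \<eta> \<le> \<bar>X T \<omega>\<bar>} \<le> expectation (\<lambda>\<omega>. (X T \<omega>)\<^sup>2) / \<eta>\<^sup>2) sequentially"
    by (rule always_eventually) (intro allI le)
  show "(\<lambda>T. expectation (\<lambda>\<omega>. (X T \<omega>)\<^sup>2) / \<eta>\<^sup>2) \<longlonglongrightarrow> 0"
    using X by (intro tendsto_divide_zero) (simp add: null_in_mean_square_def)
qed simp_all

text \<open>Bridges the two forms of independence: a hypothesis on generated sigma-algebras becomes one on random
variables, for which the product rule for expectations is stated.\<close>

lemma indep_var_of_indep_set:
  assumes indep: "indep_set (sets F) (sets G)"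
    and sp: "space F = space M" "space G = space M"
    and f: "f \<in> measurable F S" and g: "g \<in> measurable G S'"
  shows "indep_var S f S' g"
proof -
  have sub: "subalgebra M F" "subalgebra M G"
    using indep_setD_ev1[OF indep] indep_setD_ev2[OF indep] sp by (auto simp: subalgebra_def)
  have f': "sigma_sets (space M) {f -` A \<inter> space M |A. A \<in> sets S} \<subseteq> sets F"
    unfolding sp(1)[symmetric] using measurable_sets[OF f] by (auto intro!: sets.sigma_sets_subset)
  have g': "sigma_sets (space M) {g -` A \<inter> space M |A. A \<in> sets S'} \<subseteq> sets G"
    unfolding sp(2)[symmetric] using measurable_sets[OF g] by (auto intro!: sets.sigma_sets_subset)
  show ?thesis
    unfolding indep_var_eq indep_sets2_eq
  proof (intro conjI ballI)
    show "random_variable S f" by (rule measurable_from_subalg[OF sub(1) f])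
    show "random_variable S' g" by (rule measurable_from_subalg[OF sub(2) g])
    show "sigma_sets (space M) {f -` A \<inter> space M |A. A \<in> sets S} \<subseteq> events"
      by (rule order_trans[OF f' indep_setD_ev1[OF indep]])
    show "sigma_sets (space M) {g -` A \<inter> space M |A. A \<in> sets S'} \<subseteq> events"
      by (rule order_trans[OF g' indep_setD_ev2[OF indep]])
  qed (rule indep_setD[OF indep subsetD[OF f'] subsetD[OF g']])
qed

end

section \<open>Linearized moments of noisy data\<close>

lemma vcat_nth [simp]: "(u \<frown> v) $ Inl a = u $ a" "(u \<frown> v) $ Inr b = v $ b"
  by (simp_all add: vcat_def)

lemma vcat_add: "(a + b) \<frown> (c + d) = (a \<frown> c) + (b \<frown> d)"
  by (simp add: vec_eq_iff vcat_def split: sum.split)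

lemma vcat_diff: "(a - b) \<frown> (c - d) = (a \<frown> c) - (b \<frown> d)"
  by (simp add: vec_eq_iff vcat_def split: sum.split)

lemma measurable_vcat3_nth [measurable]:
  fixes f :: "'s \<Rightarrow> real ^ 'a::finite" and g :: "'s \<Rightarrow> real ^ 'b::finite" and h :: "'s \<Rightarrow> real ^ 'c::finite"
  assumes f: "f \<in> borel_measurable M" and g: "g \<in> borel_measurable M" and h: "h \<in> borel_measurable M"
  shows "(\<lambda>\<omega>. (f \<omega> \<frown> g \<omega> \<frown> h \<omega>) $ k) \<in> borel_measurable M"
proof (cases k)
  case (Inl a)
  then show ?thesis using measurable_compose[OF f borel_measurable_nth] by simp
next
  case (Inr k')
  then show ?thesis
    using measurable_compose[OF g borel_measurable_nth] measurable_compose[OF h borel_measurable_nth]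
    by (cases k') simp_all
qed

lemma vcat3_nth_le:
  fixes f :: "real ^ 'a::finite" and g :: "real ^ 'b::finite" and h :: "real ^ 'c::finite"
  assumes "norm f \<le> K" "norm g \<le> K" "norm h \<le> K"
  shows "\<bar>(f \<frown> g \<frown> h) $ k\<bar> \<le> K"
proof (cases k)
  case (Inl a)
  then show ?thesis using component_le_norm_cart[of f a] assms by simp
next
  case (Inr k')
  then show ?thesis
    using component_le_norm_cart[of g] component_le_norm_cart[of h] assms
    by (cases k') (auto intro: order_trans)
qed

lemma abs_prod_le:
  fixes f :: "'i \<Rightarrow> real"
  assumes "\<And>i. i \<in> I \<Longrightarrow> \<bar>f i\<bar> \<le> K"
  shows "\<bar>\<Prod>i\<in>I. f i\<bar> \<le> K ^ card I"
proof -
  have "(\<Prod>i\<in>I. \<bar>f i\<bar>) \<le> (\<Prod>i\<in>I. K)" by (rule prod_mono) (use assms in auto)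
  then show ?thesis by (simp add: abs_prod)
qed

text \<open>Replace the factors one at a time. Since \<open>K \<ge> 1\<close>, all powers of \<open>K\<close> that occur are at most \<open>K ^ card I\<close>.\<close>

lemma abs_prod_diff_le:
  fixes f g :: "'i \<Rightarrow> real" and K d :: real
  assumes "K \<ge> 1" "\<And>i. i \<in> I \<Longrightarrow> \<bar>f i\<bar> \<le> K" "\<And>i. i \<in> I \<Longrightarrow> \<bar>g i\<bar> \<le> K"
    and "\<And>i. i \<in> I \<Longrightarrow> \<bar>f i - g i\<bar> \<le> d"
  shows "\<bar>(\<Prod>i\<in>I. f i) - (\<Prod>i\<in>I. g i)\<bar> \<le> card I * K ^ card I * d"
  using assms(2-4)
proof (induction I rule: infinite_finite_induct)
  case (insert i I)
  have d: "d \<ge> 0" using insert.prems(3)[of i] by simp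
  have K: "K > 0" "K ^ card I \<le> K ^ Suc (card I)"
    using \<open>K \<ge> 1\<close> by (auto intro: power_increasing)
  have "f i * prod f I - g i * prod g I = f i * (prod f I - prod g I) + (f i - g i) * prod g I"
    by (simp add: algebra_simps)
  then have "\<bar>f i * prod f I - g i * prod g I\<bar>
    \<le> \<bar>f i\<bar> * \<bar>prod f I - prod g I\<bar> + \<bar>f i - g i\<bar> * \<bar>prod g I\<bar>"
    by (simp add: abs_mult[symmetric])
  also have "\<dots> \<le> K * (card I * K ^ card I * d) + d * K ^ card I"
    using insert d K by (intro add_mono mult_mono abs_prod_le) auto
  also have "\<dots> \<le> K * (card I * K ^ card I * d) + d * K ^ Suc (card I)"
    using d K by (intro add_left_mono mult_left_mono) auto
  also have "\<dots> = Suc (card I) * K ^ Suc (card I) * d" by (simp add: algebra_simps)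
  finally show ?case using insert.hyps by simp
qed (auto simp: abs_prod)

locale noisy_data = prob_space M for M :: "'s measure" +
  fixes N :: nat
    and w :: "nat \<Rightarrow> 's \<Rightarrow> real ^ 'w::enum"
    and xb v :: "nat \<Rightarrow> nat \<Rightarrow> 's \<Rightarrow> real ^ 'x::enum"
  assumes N: "N \<ge> 1"
    and A1: "assm_A1 M w"
    and A2: "assm_A2 M N w xb v"
    and A3: "assm_A3 M N xb"
begin

text \<open>The regressor of experiment \<open>i\<close> is \<open>signal i t + noise i t\<close>; the input is recorded without noise, which
gives the zero block of \<open>noise\<close>. At \<open>t = 0\<close> the truncated difference \<open>t - 1\<close> is harmless, since
moments sum over \<open>t \<ge> 1\<close>.\<close>

definition signal :: "nat \<Rightarrow> nat \<Rightarrow> 's \<Rightarrow> real ^ ('x + 'x + 'w)"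
  where "signal i t \<omega> = xb i t \<omega> \<frown> xb i (t - 1) \<omega> \<frown> w t \<omega>"

definition noise :: "nat \<Rightarrow> nat \<Rightarrow> 's \<Rightarrow> real ^ ('x + 'x + 'w)"
  where "noise i t \<omega> = v i t \<omega> \<frown> v i (t - 1) \<omega> \<frown> 0"

lemma measurable_w [measurable]: "w t \<in> borel_measurable M"
  using A1 by (simp add: assm_A1_def bounded_process_def)

lemma measurable_xb [measurable]: "i \<in> {1..N} \<Longrightarrow> xb i t \<in> borel_measurable M"
  using A3 unfolding assm_A3_def by blast

lemma measurable_v [measurable]: "i \<in> {1..N} \<Longrightarrow> v i t \<in> borel_measurable M"
  using A2 unfolding assm_A2_def bounded_process_def by blast

lemma measurable_signal: "i \<in> {1..N} \<Longrightarrow> (\<lambda>\<omega>. signal i t \<omega> $ k) \<in> borel_measurable M"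
  unfolding signal_def by (intro measurable_vcat3_nth measurable_w measurable_xb)

lemma measurable_noise: "i \<in> {1..N} \<Longrightarrow> (\<lambda>\<omega>. noise i t \<omega> $ k) \<in> borel_measurable M"
  unfolding noise_def by (intro measurable_vcat3_nth measurable_v borel_measurable_const)

lemma uniform_bound:
  obtains K where "K \<ge> 1"
    and "AE \<omega> in M. \<forall>i\<in>{1..N}. \<forall>t k. \<bar>signal i t \<omega> $ k\<bar> \<le> K \<and> \<bar>noise i t \<omega> $ k\<bar> \<le> K"
proof -
  obtain Kw where Kw: "AE \<omega> in M. \<forall>t. norm (w t \<omega>) \<le> Kw"
    using A1 unfolding assm_A1_def bounded_process_def by blast
  obtain Kx where Kx: "AE \<omega> in M. \<forall>i\<in>{1..N}. \<forall>t. norm (xb i t \<omega>) \<le> Kx"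
    using A3 unfolding assm_A3_def by blast
  have "\<forall>i\<in>{1..N}. \<exists>K. AE \<omega> in M. \<forall>t. norm (v i t \<omega>) \<le> K"
    using A2 unfolding assm_A2_def bounded_process_def by blast
  then obtain Kv where Kv: "\<And>i. i \<in> {1..N} \<Longrightarrow> AE \<omega> in M. \<forall>t. norm (v i t \<omega>) \<le> Kv i"
    by metis
  then have Kv: "AE \<omega> in M. \<forall>i\<in>{1..N}. \<forall>t. norm (v i t \<omega>) \<le> Kv i"
    by (intro AE_finite_allI) auto
  define K where "K = 1 + \<bar>Kw\<bar> + \<bar>Kx\<bar> + (\<Sum>i=1..N. \<bar>Kv i\<bar>)"
  have le: "Kw \<le> K" "Kx \<le> K" "1 \<le> K" "\<And>i. i \<in> {1..N} \<Longrightarrow> Kv i \<le> K"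
  proof -
    have s: "0 \<le> (\<Sum>i=1..N. \<bar>Kv i\<bar>)" by (simp add: sum_nonneg)
    show "Kw \<le> K" "Kx \<le> K" "1 \<le> K" unfolding K_def using s by linarith+
    show "Kv i \<le> K" if "i \<in> {1..N}" for i
      using member_le_sum[OF that, of "\<lambda>i. \<bar>Kv i\<bar>"] by (simp add: K_def)
  qed
  show thesis
  proof
    show "AE \<omega> in M. \<forall>i\<in>{1..N}. \<forall>t k. \<bar>signal i t \<omega> $ k\<bar> \<le> K \<and> \<bar>noise i t \<omega> $ k\<bar> \<le> K"
      using Kw Kx Kv
    proof eventually_elim
      case (elim \<omega>)
      have "norm (w t \<omega>) \<le> K" "i \<in> {1..N} \<Longrightarrow> norm (xb i t \<omega>) \<le> K" "i \<in> {1..N} \<Longrightarrow> norm (v i t \<omega>) \<le> K" for i t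
        using elim le by (meson order_trans)+
      moreover have "norm (0 :: real ^ 'w::enum) \<le> K" using le by simp
      ultimately show ?case
        unfolding signal_def noise_def by (intro ballI allI conjI vcat3_nth_le)
    qed
  qed (rule le)
qed

text \<open>For a fixed component \<open>k\<close>, both factors are the same coordinate of the noise with the same delay (0 or 1), taken at
distinct times because \<open>s\<close> and \<open>t\<close> are distinct and positive. They are therefore independent and
centred. Components belonging to the input carry no noise.\<close>

lemma noise_cross_moment:
  assumes i: "i \<in> {1..N}" and st: "s \<ge> 1" "t \<ge> 1" "s \<noteq> t"
  shows "expectation (\<lambda>\<omega>. noise i s \<omega> $ k * noise i t \<omega> $ k) = 0"
proof -
  have ind: "indep_vars (\<lambda>_. borel) (v i) UNIV" and mean: "expectation (v i t) = 0" for t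
    using A2 i unfolding assm_A2_def by auto
  obtain K where K: "AE \<omega> in M. \<forall>t. norm (v i t \<omega>) \<le> K"
    using A2 i unfolding assm_A2_def bounded_process_def by blast
  have [measurable]: "v i t \<in> borel_measurable M" for t using i by (rule measurable_v)
  have int: "integrable M (v i t)" for t
    by (rule integrable_const_bound[of _ K]) (use K in auto)
  have *: "expectation (\<lambda>\<omega>. v i s \<omega> $ a * v i t \<omega> $ a) = 0" if "s \<noteq> t" for s t a
  proof -
    have lin: "bounded_linear (\<lambda>u :: real ^ 'x::enum. u $ a)" by (rule bounded_linear_vec_nth)
    have m: "expectation (\<lambda>\<omega>. v i t \<omega> $ a) = 0" for t
      using integral_bounded_linear[OF lin int[of t]] mean[of t] by simp
    have "indep_vars (\<lambda>_. borel) (\<lambda>t \<omega>. v i t \<omega> $ a) {s, t}"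
      by (rule indep_vars_compose2[OF indep_vars_subset[OF ind]]) auto
    then have "expectation (\<lambda>\<omega>. \<Prod>t\<in>{s, t}. v i t \<omega> $ a) = (\<Prod>t\<in>{s, t}. expectation (\<lambda>\<omega>. v i t \<omega> $ a))"
      using integrable_bounded_linear[OF lin int] by (intro indep_vars_lebesgue_integral) auto
    then show ?thesis using that m by simp
  qed
  show ?thesis
  proof (cases k)
    case (Inl a)
    then show ?thesis using *[OF st(3), of a] by (simp add: noise_def)
  next
    case (Inr k')
    have "s - 1 \<noteq> t - 1" using st by auto
    then show ?thesis using Inr * by (cases k') (simp_all add: noise_def)
  qed
qed

lemma noise_signal_indep:
  assumes S: "S \<subseteq> {1..N}" and J: "J \<subseteq> {1..N}"
  shows "indep_var borel (\<lambda>\<omega>. \<Prod>i\<in>S. noise i s \<omega> $ k i * noise i t \<omega> $ k i)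
    borel (\<lambda>\<omega>. \<Prod>i\<in>J. signal i s \<omega> $ k i * signal i t \<omega> $ k i)"
proof -
  let ?Pv = "\<Pi>\<^sub>M i\<in>{1..N}. \<Pi>\<^sub>M t\<in>(UNIV :: nat set). (borel :: (real ^ 'x::enum) measure)"
  let ?Pw = "(\<Pi>\<^sub>M t\<in>(UNIV :: nat set). (borel :: (real ^ 'w::enum) measure)) \<Otimes>\<^sub>M ?Pv"
  define fv where "fv = (\<lambda>\<omega>. \<lambda>i\<in>{1..N}. \<lambda>t. v i t \<omega>)"
  define fw where "fw = (\<lambda>\<omega>. (\<lambda>t. w t \<omega>, \<lambda>i\<in>{1..N}. \<lambda>t. xb i t \<omega>))"
  let ?V = "vimage_algebra (space M) fv ?Pv" and ?W = "vimage_algebra (space M) fw ?Pw"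
  have indep: "indep_set (sets ?V) (sets ?W)"
    using A2 unfolding assm_A2_def fv_def fw_def by blast
  have fv: "fv \<in> measurable ?V ?Pv"
    by (rule measurable_vimage_algebra1) (auto simp: fv_def space_PiM)
  have fw: "fw \<in> measurable ?W ?Pw"
    by (rule measurable_vimage_algebra1) (auto simp: fw_def space_PiM space_pair_measure)
  have v: "v i t \<in> borel_measurable ?V" if i: "i \<in> {1..N}" for i t
  proof -
    have "(\<lambda>\<omega>. fv \<omega> i t) \<in> borel_measurable ?V"
      using i by (intro measurable_compose[OF measurable_compose[OF fv measurable_component_singleton]
          measurable_component_singleton]) auto
    then show ?thesis using i by (simp add: fv_def)
  qed
  have w: "w t \<in> borel_measurable ?W" for t
  proof -
    have "(\<lambda>\<omega>. fst (fw \<omega>) t) \<in> borel_measurable ?W"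
      by (intro measurable_compose[OF measurable_compose[OF fw measurable_fst]
          measurable_component_singleton]) auto
    then show ?thesis by (simp add: fw_def)
  qed
  have xb: "xb i t \<in> borel_measurable ?W" if i: "i \<in> {1..N}" for i t
  proof -
    have "(\<lambda>\<omega>. snd (fw \<omega>) i t) \<in> borel_measurable ?W"
      using i by (intro measurable_compose[OF measurable_compose[OF measurable_compose[OF fw measurable_snd]
          measurable_component_singleton] measurable_component_singleton]) auto
    then show ?thesis using i by (simp add: fw_def)
  qed
  show ?thesis
  proof (rule indep_var_of_indep_set[OF indep])
    show "(\<lambda>\<omega>. \<Prod>i\<in>S. noise i s \<omega> $ k i * noise i t \<omega> $ k i) \<in> borel_measurable ?V"
      unfolding noise_def using S
      by (intro borel_measurable_prod borel_measurable_times measurable_vcat3_nth v borel_measurable_const) auto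
    show "(\<lambda>\<omega>. \<Prod>i\<in>J. signal i s \<omega> $ k i * signal i t \<omega> $ k i) \<in> borel_measurable ?W"
      unfolding signal_def using J
      by (intro borel_measurable_prod borel_measurable_times measurable_vcat3_nth w xb) auto
  qed simp_all
qed

text \<open>Each experiment occurs once in the product. This is what linearization buys: the expectation
factorizes over experiments, and every factor vanishes.\<close>

lemma noise_prod_mean:
  assumes S: "S \<subseteq> {1..N}" "S \<noteq> {}" and st: "s \<ge> 1" "t \<ge> 1" "s \<noteq> t"
  shows "expectation (\<lambda>\<omega>. \<Prod>i\<in>S. noise i s \<omega> $ k i * noise i t \<omega> $ k i) = 0"
proof -
  have fin: "finite S" using S(1) by (rule finite_subset) simp
  obtain K where "K \<ge> 1" and
    K: "AE \<omega> in M. \<forall>i\<in>{1..N}. \<forall>t k. \<bar>signal i t \<omega> $ k\<bar> \<le> K \<and> \<bar>noise i t \<omega> $ k\<bar> \<le> K"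
    by (rule uniform_bound)
  have "indep_vars (\<lambda>_. \<Pi>\<^sub>M t\<in>UNIV. borel) (\<lambda>i \<omega> t. v i t \<omega>) S"
    using A2 S unfolding assm_A2_def by (blast intro: indep_vars_subset)
  then have "indep_vars (\<lambda>_. borel)
      (\<lambda>i \<omega>. (v i s \<omega> \<frown> v i (s - 1) \<omega> \<frown> (0 :: real ^ 'w::enum)) $ k i * (v i t \<omega> \<frown> v i (t - 1) \<omega> \<frown> (0 :: real ^ 'w::enum)) $ k i) S"
  proof (rule indep_vars_compose2[where Y = "\<lambda>i u. (u s \<frown> u (s - 1) \<frown> (0 :: real ^ 'w::enum)) $ k i * (u t \<frown> u (t - 1) \<frown> (0 :: real ^ 'w::enum)) $ k i"])
    show "(\<lambda>u. (u s \<frown> u (s - 1) \<frown> (0 :: real ^ 'w::enum)) $ k i * (u t \<frown> u (t - 1) \<frown> (0 :: real ^ 'w::enum)) $ k i)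
      \<in> borel_measurable (\<Pi>\<^sub>M t\<in>(UNIV :: nat set). (borel :: (real ^ 'x::enum) measure))" for i
      by (intro borel_measurable_times measurable_vcat3_nth measurable_component_singleton borel_measurable_const) auto
  qed
  then have "indep_vars (\<lambda>_. borel) (\<lambda>i \<omega>. noise i s \<omega> $ k i * noise i t \<omega> $ k i) S"
    unfolding noise_def .
  moreover have "integrable M (\<lambda>\<omega>. noise i s \<omega> $ k i * noise i t \<omega> $ k i)" if "i \<in> S" for i
  proof (rule integrable_const_bound[of _ "K * K"])
    show "AE \<omega> in M. norm (noise i s \<omega> $ k i * noise i t \<omega> $ k i) \<le> K * K"
      using K
    proof eventually_elim
      case (elim \<omega>)
      then show ?case using that S \<open>K \<ge> 1\<close> by (auto simp: abs_mult intro!: mult_mono)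
    qed
    show "(\<lambda>\<omega>. noise i s \<omega> $ k i * noise i t \<omega> $ k i) \<in> borel_measurable M"
      using that S by (intro borel_measurable_times measurable_noise) auto
  qed
  ultimately have "expectation (\<lambda>\<omega>. \<Prod>i\<in>S. noise i s \<omega> $ k i * noise i t \<omega> $ k i)
    = (\<Prod>i\<in>S. expectation (\<lambda>\<omega>. noise i s \<omega> $ k i * noise i t \<omega> $ k i))"
    by (intro indep_vars_lebesgue_integral fin)
  also have "\<dots> = 0"
  proof (rule prod_zero[OF fin])
    obtain i where "i \<in> S" using S(2) by blast
    then show "\<exists>i\<in>S. expectation (\<lambda>\<omega>. noise i s \<omega> $ k i * noise i t \<omega> $ k i) = 0"
      using S(1) by (intro bexI[of _ i] noise_cross_moment[OF _ st]) auto
  qed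
  finally show ?thesis .
qed

text \<open>Terms at distinct times are orthogonal: the noise is independent of the signals, and its part of the product of
two terms has mean 0 as soon as \<open>S\<close> is nonempty.\<close>

lemma noise_terms_null:
  assumes S: "S \<subseteq> {1..N}" "S \<noteq> {}" and J: "J \<subseteq> {1..N}"
  shows "null_in_mean_square M (\<lambda>T \<omega>. (1 / real T) *
    (\<Sum>t=1..T. (\<Prod>i\<in>S. noise i t \<omega> $ k i) * (\<Prod>i\<in>J. signal i t \<omega> $ k i)))"
proof -
  obtain K where "K \<ge> 1" and
    K: "AE \<omega> in M. \<forall>i\<in>{1..N}. \<forall>t k. \<bar>signal i t \<omega> $ k\<bar> \<le> K \<and> \<bar>noise i t \<omega> $ k\<bar> \<le> K"
    by (rule uniform_bound)
  let ?F = "\<lambda>s t \<omega>. \<Prod>i\<in>S. noise i s \<omega> $ k i * noise i t \<omega> $ k i"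
  let ?G = "\<lambda>s t \<omega>. \<Prod>i\<in>J. signal i s \<omega> $ k i * signal i t \<omega> $ k i"
  have F_int: "integrable M (?F s t)" for s t
  proof (rule integrable_const_bound[of _ "(K * K) ^ card S"])
    show "AE \<omega> in M. norm (?F s t \<omega>) \<le> (K * K) ^ card S"
      using K
    proof eventually_elim
      case (elim \<omega>)
      then show ?case unfolding real_norm_def
        by (intro abs_prod_le) (use elim S \<open>K \<ge> 1\<close> in \<open>auto simp: abs_mult intro!: mult_mono\<close>)
    qed
    show "?F s t \<in> borel_measurable M"
      using S by (intro borel_measurable_prod borel_measurable_times measurable_noise) auto
  qed
  have G_int: "integrable M (?G s t)" for s t
  proof (rule integrable_const_bound[of _ "(K * K) ^ card J"])
    show "AE \<omega> in M. norm (?G s t \<omega>) \<le> (K * K) ^ card J"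
      using K
    proof eventually_elim
      case (elim \<omega>)
      then show ?case unfolding real_norm_def
        by (intro abs_prod_le) (use elim J \<open>K \<ge> 1\<close> in \<open>auto simp: abs_mult intro!: mult_mono\<close>)
    qed
    show "?G s t \<in> borel_measurable M"
      using J by (intro borel_measurable_prod borel_measurable_times measurable_signal) auto
  qed
  show ?thesis
  proof (rule null_in_mean_square_average[where K = "K ^ card S * K ^ card J"])
    show "(\<lambda>\<omega>. (\<Prod>i\<in>S. noise i t \<omega> $ k i) * (\<Prod>i\<in>J. signal i t \<omega> $ k i)) \<in> borel_measurable M" for t
      using S J by (intro borel_measurable_prod borel_measurable_times measurable_signal measurable_noise) auto
    show "AE \<omega> in M. \<bar>(\<Prod>i\<in>S. noise i t \<omega> $ k i) * (\<Prod>i\<in>J. signal i t \<omega> $ k i)\<bar> \<le> K ^ card S * K ^ card J" for t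
      using K
    proof eventually_elim
      case (elim \<omega>)
      then show ?case unfolding abs_mult
        by (intro mult_mono abs_prod_le) (use elim S J \<open>K \<ge> 1\<close> in auto)
    qed
    fix s t :: nat assume st: "s \<ge> 1" "t \<ge> 1" "s \<noteq> t"
    have "expectation (\<lambda>\<omega>. ?F s t \<omega> * ?G s t \<omega>) = expectation (?F s t) * expectation (?G s t)"
      by (rule indep_var_lebesgue_integral[OF noise_signal_indep[OF S(1) J] F_int G_int])
    then show "expectation (\<lambda>\<omega>. (\<Prod>i\<in>S. noise i s \<omega> $ k i) * (\<Prod>i\<in>J. signal i s \<omega> $ k i) *
        ((\<Prod>i\<in>S. noise i t \<omega> $ k i) * (\<Prod>i\<in>J. signal i t \<omega> $ k i))) = 0"
      using noise_prod_mean[OF S st, of k] by (simp add: prod.distrib mult_ac)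
  qed
qed

text \<open>Without noise, a linearized monomial differs from the monomial of a single experiment only through the
transient that (A3) makes geometrically small. The time average of a summable sequence is
\<open>O(1/T)\<close>.\<close>

lemma signal_terms_null:
  assumes J: "J \<subseteq> {1..N}" and j: "j \<in> {1..N}"
  shows "null_in_mean_square M (\<lambda>T \<omega>. (1 / real T) *
    (\<Sum>t=1..T. (\<Prod>i\<in>J. signal i t \<omega> $ k i) - (\<Prod>i\<in>J. signal j t \<omega> $ k i)))"
proof -
  obtain K where "K \<ge> 1" and
    K: "AE \<omega> in M. \<forall>i\<in>{1..N}. \<forall>t k. \<bar>signal i t \<omega> $ k\<bar> \<le> K \<and> \<bar>noise i t \<omega> $ k\<bar> \<le> K"
    by (rule uniform_bound)
  obtain c \<rho> where c: "c > 0" and \<rho>: "0 < \<rho>" "\<rho> < 1"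
    and sync: "AE \<omega> in M. \<forall>i\<in>{1..N}. \<forall>j\<in>{1..N}. \<forall>t. norm (xb i t \<omega> - xb j t \<omega>) \<le> c * \<rho> ^ t"
    using A3 unfolding assm_A3_def by blast
  define B where "B = card J * K ^ card J * (c / (1 - \<rho>))"
  show ?thesis
  proof (rule null_in_mean_square_bounded)
    show "(\<lambda>T. B / real T) \<longlonglongrightarrow> 0" by (rule lim_const_over_n)
    show "(\<lambda>\<omega>. (1 / real T) * (\<Sum>t=1..T. (\<Prod>i\<in>J. signal i t \<omega> $ k i) - (\<Prod>i\<in>J. signal j t \<omega> $ k i)))
      \<in> borel_measurable M" for T
      using J j
      by (intro borel_measurable_times borel_measurable_const borel_measurable_sum borel_measurable_diff
          borel_measurable_prod measurable_signal) auto
    show "AE \<omega> in M. \<bar>(1 / real T) * (\<Sum>t=1..T. (\<Prod>i\<in>J. signal i t \<omega> $ k i) - (\<Prod>i\<in>J. signal j t \<omega> $ k i))\<bar>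
      \<le> B / real T" for T
      using K sync
    proof eventually_elim
      case (elim \<omega>)
      have diff: "\<bar>signal i t \<omega> $ l - signal j t \<omega> $ l\<bar> \<le> c * \<rho> ^ (t - 1)" if i: "i \<in> {1..N}" for i t l
      proof -
        have "norm (xb i t \<omega> - xb j t \<omega>) \<le> c * \<rho> ^ t" using elim(2) i j by blast
        also have "\<dots> \<le> c * \<rho> ^ (t - 1)"
          using c \<rho> by (intro mult_left_mono power_decreasing) auto
        finally have "norm (xb i t \<omega> - xb j t \<omega>) \<le> c * \<rho> ^ (t - 1)" .
        moreover have "norm (xb i (t - 1) \<omega> - xb j (t - 1) \<omega>) \<le> c * \<rho> ^ (t - 1)"
          using elim(2) i j by blast
        moreover have "norm (w t \<omega> - w t \<omega>) \<le> c * \<rho> ^ (t - 1)" using c \<rho> by simp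
        ultimately have "\<bar>((xb i t \<omega> - xb j t \<omega>) \<frown> (xb i (t - 1) \<omega> - xb j (t - 1) \<omega>) \<frown> (w t \<omega> - w t \<omega>)) $ l\<bar>
          \<le> c * \<rho> ^ (t - 1)"
          by (rule vcat3_nth_le)
        then show ?thesis by (simp only: signal_def vcat_diff vector_minus_component)
      qed
      have "\<bar>\<Sum>t=1..T. (\<Prod>i\<in>J. signal i t \<omega> $ k i) - (\<Prod>i\<in>J. signal j t \<omega> $ k i)\<bar>
        \<le> (\<Sum>t=1..T. card J * K ^ card J * (c * \<rho> ^ (t - 1)))"
        using elim(1) J j diff \<open>K \<ge> 1\<close>
        by (intro order_trans[OF sum_abs] sum_mono abs_prod_diff_le) auto
      also have "\<dots> = card J * K ^ card J * (c * (\<Sum>t<T. \<rho> ^ t))"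
        unfolding sum_distrib_left
        by (rule sum.reindex_bij_witness[of _ Suc "\<lambda>t. t - 1"]) auto
      also have "\<dots> \<le> B"
        unfolding B_def
      proof (intro mult_left_mono)
        have "c * (\<Sum>t<T. \<rho> ^ t) = c * ((1 - \<rho> ^ T) / (1 - \<rho>))"
          using \<rho> by (simp add: sum_gp_strict)
        also have "\<dots> \<le> c * (1 / (1 - \<rho>))"
          using c \<rho> by (intro mult_left_mono divide_right_mono) auto
        finally show "c * (\<Sum>t<T. \<rho> ^ t) \<le> c / (1 - \<rho>)" by simp
      qed (use \<open>K \<ge> 1\<close> in auto)
      finally show ?case by (simp add: divide_right_mono)
    qed
  qed
qed

text \<open>Expand the product of (noise + signal) over the experiments into a sum over the set \<open>S\<close> of experiments from
which the noise is taken. The nonempty \<open>S\<close> average out; the empty one is the linearized moment of the noiseless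
signals, which differ by a vanishing transient.\<close>

lemma lin_moment_consistent:
  assumes d: "mdeg \<alpha> \<le> N"
  shows "null_in_mean_square M (\<lambda>T \<omega>. lin_moment T (\<lambda>t. w t \<omega>) (\<lambda>i t. xb i t \<omega> + v i t \<omega>) \<alpha>
    - (1 / real N) * (\<Sum>j=1..N. moment T (\<lambda>t. w t \<omega>) (\<lambda>t. xb j t \<omega>) \<alpha>))"
proof -
  let ?D = "{1..mdeg \<alpha>}" and ?k = "\<lambda>i. coord (beta \<alpha> i)"
  have D: "?D \<subseteq> {1..N}" using d by auto
  let ?n = "\<lambda>S t \<omega>. \<Prod>i\<in>S. noise i t \<omega> $ ?k i" and ?s = "\<lambda>S t \<omega>. \<Prod>i\<in>S. signal i t \<omega> $ ?k i"
  let ?m = "\<lambda>j t \<omega>. \<Prod>i\<in>?D. signal j t \<omega> $ ?k i"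
  let ?A = "\<lambda>T \<omega>. \<Sum>S\<in>Pow ?D - {{}}. (1 / real T) * (\<Sum>t=1..T. ?n S t \<omega> * ?s (?D - S) t \<omega>)"
  let ?B = "\<lambda>T \<omega>. \<Sum>j=1..N. (1 / real T) * (\<Sum>t=1..T. ?s ?D t \<omega> - ?m j t \<omega>)"
  have split: "lin_moment T (\<lambda>t. w t \<omega>) (\<lambda>i t. xb i t \<omega> + v i t \<omega>) \<alpha>
    - (1 / real N) * (\<Sum>j=1..N. moment T (\<lambda>t. w t \<omega>) (\<lambda>t. xb j t \<omega>) \<alpha>)
    = ?A T \<omega> + (1 / real N) * ?B T \<omega>" for T \<omega>
  proof -
    have "(xb i t \<omega> + v i t \<omega>) \<frown> (xb i (t - 1) \<omega> + v i (t - 1) \<omega>) \<frown> w t \<omega> = noise i t \<omega> + signal i t \<omega>" for i t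
      by (simp add: noise_def signal_def vcat_add[symmetric] add.commute)
    then have "lin_moment T (\<lambda>t. w t \<omega>) (\<lambda>i t. xb i t \<omega> + v i t \<omega>) \<alpha>
      = (1 / real T) * (\<Sum>t=1..T. \<Prod>i\<in>?D. noise i t \<omega> $ ?k i + signal i t \<omega> $ ?k i)"
      by (simp add: lin_moment_def)
    also have "\<dots> = (1 / real T) * (\<Sum>t=1..T. \<Sum>S\<in>Pow ?D. ?n S t \<omega> * ?s (?D - S) t \<omega>)"
      by (simp only: prod_add[OF finite_atLeastAtMost])
    also have "\<dots> = (1 / real T) * (\<Sum>t=1..T. ?s ?D t \<omega>) + ?A T \<omega>"
    proof -
      have "(\<Sum>S\<in>Pow ?D. g S) = g {} + (\<Sum>S\<in>Pow ?D - {{}}. g S)" for g :: "nat set \<Rightarrow> real"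
        by (rule sum.remove) auto
      then have "(\<Sum>t=1..T. \<Sum>S\<in>Pow ?D. ?n S t \<omega> * ?s (?D - S) t \<omega>)
        = (\<Sum>t=1..T. ?s ?D t \<omega>) + (\<Sum>t=1..T. \<Sum>S\<in>Pow ?D - {{}}. ?n S t \<omega> * ?s (?D - S) t \<omega>)"
        by (simp only: sum.distrib Diff_empty prod.empty mult_1_left)
      also have "(\<Sum>t=1..T. \<Sum>S\<in>Pow ?D - {{}}. ?n S t \<omega> * ?s (?D - S) t \<omega>)
        = (\<Sum>S\<in>Pow ?D - {{}}. \<Sum>t=1..T. ?n S t \<omega> * ?s (?D - S) t \<omega>)"
        by (rule sum.swap)
      finally show ?thesis by (simp only: distrib_left sum_distrib_left)
    qed
    finally have lin: "lin_moment T (\<lambda>t. w t \<omega>) (\<lambda>i t. xb i t \<omega> + v i t \<omega>) \<alpha>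
      = (1 / real T) * (\<Sum>t=1..T. ?s ?D t \<omega>) + ?A T \<omega>" .
    have "(1 / real N) * ?B T \<omega> = (1 / real N) * (\<Sum>j=1..N. (1 / real T) * (\<Sum>t=1..T. ?s ?D t \<omega>)
        - moment T (\<lambda>t. w t \<omega>) (\<lambda>t. xb j t \<omega>) \<alpha>)"
      by (simp only: moment_def signal_def[symmetric] prod_beta_eq_vpow[symmetric]
          sum_subtractf right_diff_distrib)
    also have "\<dots> = (1 / real T) * (\<Sum>t=1..T. ?s ?D t \<omega>)
        - (1 / real N) * (\<Sum>j=1..N. moment T (\<lambda>t. w t \<omega>) (\<lambda>t. xb j t \<omega>) \<alpha>)"
      using N by (simp add: sum_subtractf right_diff_distrib)
    finally show ?thesis using lin by simp
  qed
  have "null_in_mean_square M ?A"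
    by (intro null_in_mean_square_sum noise_terms_null) (use D in auto)
  moreover have "null_in_mean_square M (\<lambda>T \<omega>. (1 / real N) * ?B T \<omega>)"
    by (intro null_in_mean_square_cmult null_in_mean_square_sum signal_terms_null D)
  ultimately show ?thesis
    unfolding split by (rule null_in_mean_square_add)
qed

end

section \<open>Near-optimality of the minimizer\<close>

text \<open>The noiseless moment matrix lies in the cone, so projecting the symmetrized empirical matrix at most doubles
its distance from it.\<close>

lemma M_hat_close:
  fixes w :: "nat \<Rightarrow> real ^ 'w::enum" and x xb :: "nat \<Rightarrow> nat \<Rightarrow> real ^ 'x::enum"
    and \<eta> :: real
  assumes "\<And>\<alpha>. mdeg \<alpha> \<le> N \<Longrightarrow>
    \<bar>lin_moment T w x \<alpha> - (1 / real N) * (\<Sum>j=1..N. moment T w (xb j) \<alpha>)\<bar> \<le> \<eta>"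
  shows "frob (aleph N) (\<lambda>\<alpha> \<beta>. M_hat N T w x \<alpha> \<beta> - M_bar N T w xb \<alpha> \<beta>)
    \<le> 2 * ((card (aleph N :: (nat ^ ('x + 'x + 'w)) set))\<^sup>2 * \<eta>)"
proof -
  let ?I = "aleph N :: (nat ^ ('x + 'x + 'w)) set"
  let ?A = "\<lambda>\<alpha> \<beta>. (M_tilde N T w x \<alpha> \<beta> + M_tilde N T w x \<beta> \<alpha>) / 2"
  have "frob ?I (\<lambda>\<alpha> \<beta>. M_hat N T w x \<alpha> \<beta> - M_bar N T w xb \<alpha> \<beta>)
    \<le> 2 * frob ?I (\<lambda>\<alpha> \<beta>. ?A \<alpha> \<beta> - M_bar N T w xb \<alpha> \<beta>)"
    unfolding M_hat_def by (rule psd_proj_close[OF finite_aleph M_bar_psd])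
  also have "\<dots> \<le> 2 * ((card ?I)\<^sup>2 * \<eta>)"
  proof (intro mult_left_mono frob_le_entries finite_aleph)
    fix \<alpha> \<beta> :: "nat ^ ('x + 'x + 'w)" assume I: "\<alpha> \<in> ?I" "\<beta> \<in> ?I"
    then have "mdeg (\<alpha> + \<beta>) \<le> N" by (simp add: aleph_def mdeg_def sum.distrib)
    moreover have "?A \<alpha> \<beta> - M_bar N T w xb \<alpha> \<beta>
      = lin_moment T w x (\<alpha> + \<beta>) - (1 / real N) * (\<Sum>j=1..N. moment T w (xb j) (\<alpha> + \<beta>))"
      using I by (simp add: M_tilde_def M_bar_def mk_mat_def add.commute)
    ultimately show "\<bar>?A \<alpha> \<beta> - M_bar N T w xb \<alpha> \<beta>\<bar> \<le> \<eta>" using assms by simp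
  qed simp
  finally show ?thesis .
qed

text \<open>The objective is linear in its data: replacing \<open>B\<close> by \<open>A\<close> moves the values at both candidates by at most \<open>K * e\<close>.
This is where the bound on the Frobenius norm enters.\<close>

lemma minimizer_near_optimal:
  assumes opt: "tr_mult I R1 B \<le> tr_mult I R2 B"
    and close: "frob I (\<lambda>i j. B i j - A i j) \<le> e"
    and R: "frob I R1 \<le> K" "frob I R2 \<le> K"
  shows "tr_mult I R1 A \<le> 2 * (K * e) + tr_mult I R2 A"
proof -
  have "\<bar>tr_mult I R (\<lambda>i j. B i j - A i j)\<bar> \<le> K * e" if "frob I R \<le> K" for R
    using that close order_trans[OF frob_nonneg that]
    by (intro order_trans[OF abs_tr_mult_le] mult_mono) auto
  from this[OF R(1)] this[OF R(2)] show ?thesis using opt by (simp add: tr_mult_diff_right)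
qed

context noisy_data
begin

text \<open>Finitely many exponents are involved, so Chebyshev's inequality and a union bound give one event on which all
their moments are accurate.\<close>

lemma uniformly_consistent:
  assumes \<eta>: "\<eta> > 0" and \<gamma>: "\<gamma> > 0"
  obtains T A where "T \<ge> 1" "A \<in> events" "prob A \<ge> 1 - \<gamma>"
    "\<And>\<omega> \<alpha>. \<omega> \<in> A \<Longrightarrow> mdeg \<alpha> \<le> N \<Longrightarrow>
      \<bar>lin_moment T (\<lambda>t. w t \<omega>) (\<lambda>i t. xb i t \<omega> + v i t \<omega>) \<alpha>
        - (1 / real N) * (\<Sum>j=1..N. moment T (\<lambda>t. w t \<omega>) (\<lambda>t. xb j t \<omega>) \<alpha>)\<bar> \<le> \<eta>"
proof -
  let ?L = "{\<alpha> :: nat ^ ('x + 'x + 'w). mdeg \<alpha> \<le> N}"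
  define Z where "Z \<alpha> T \<omega> = lin_moment T (\<lambda>t. w t \<omega>) (\<lambda>i t. xb i t \<omega> + v i t \<omega>) \<alpha>
    - (1 / real N) * (\<Sum>j=1..N. moment T (\<lambda>t. w t \<omega>) (\<lambda>t. xb j t \<omega>) \<alpha>)"
    for \<alpha> :: "nat ^ ('x + 'x + 'w)" and T and \<omega>
  define bad where "bad \<alpha> T = {\<omega>\<in>space M. \<eta> \<le> \<bar>Z \<alpha> T \<omega>\<bar>}" for \<alpha> T
  have null: "null_in_mean_square M (Z \<alpha>)" if "\<alpha> \<in> ?L" for \<alpha>
    unfolding Z_def by (rule lin_moment_consistent) (use that in simp)
  have meas: "bad \<alpha> T \<in> events" if "\<alpha> \<in> ?L" for \<alpha> T
  proof -
    have [measurable]: "Z \<alpha> T \<in> borel_measurable M"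
      using null[OF that] by (simp add: null_in_mean_square_def)
    show ?thesis unfolding bad_def by measurable
  qed
  have "(\<lambda>T. \<Sum>\<alpha>\<in>?L. prob (bad \<alpha> T)) \<longlonglongrightarrow> (\<Sum>\<alpha>\<in>?L. 0)"
    unfolding bad_def by (intro tendsto_sum null_in_mean_square_prob null \<eta>)
  then have "eventually (\<lambda>T. (\<Sum>\<alpha>\<in>?L. prob (bad \<alpha> T)) < \<gamma>) sequentially"
    using \<gamma> by (auto dest: order_tendstoD(2))
  then have "eventually (\<lambda>T. (\<Sum>\<alpha>\<in>?L. prob (bad \<alpha> T)) < \<gamma> \<and> T \<ge> 1) sequentially"
    by (intro eventually_conj eventually_ge_at_top)
  then obtain T where T: "(\<Sum>\<alpha>\<in>?L. prob (bad \<alpha> T)) < \<gamma>" "T \<ge> 1"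
    by (auto dest: eventually_happens)
  define A where "A = space M - (\<Union>\<alpha>\<in>?L. bad \<alpha> T)"
  have U: "(\<Union>\<alpha>\<in>?L. bad \<alpha> T) \<in> events"
    using meas by (intro sets.finite_UN finite_mdeg_le)
  show thesis
  proof (rule that[OF T(2)])
    show "A \<in> events" unfolding A_def using U by simp
    have "prob (\<Union>\<alpha>\<in>?L. bad \<alpha> T) \<le> (\<Sum>\<alpha>\<in>?L. prob (bad \<alpha> T))"
      using meas by (intro finite_measure_subadditive_finite finite_mdeg_le) auto
    then show "prob A \<ge> 1 - \<gamma>"
      unfolding A_def using T(1) prob_compl[OF U] by simp
    fix \<omega> and \<alpha> :: "nat ^ ('x + 'x + 'w)"
    assume "\<omega> \<in> A" "mdeg \<alpha> \<le> N"
    then have "\<bar>Z \<alpha> T \<omega>\<bar> \<le> \<eta>" by (auto simp: A_def bad_def)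
    then show "\<bar>lin_moment T (\<lambda>t. w t \<omega>) (\<lambda>i t. xb i t \<omega> + v i t \<omega>) \<alpha>
        - (1 / real N) * (\<Sum>j=1..N. moment T (\<lambda>t. w t \<omega>) (\<lambda>t. xb j t \<omega>) \<alpha>)\<bar> \<le> \<eta>"
      unfolding Z_def .
  qed
qed

end

lemma average_simulation_error_le_trace:
  fixes \<phi> :: "'k::finite \<Rightarrow> (real ^ 'x::finite) \<times> (real ^ 'w::finite) \<Rightarrow> real ^ 'x"
  assumes feas: "(\<theta>, r, R) \<in> feasible C \<phi> \<psi> N \<delta> Pi_map \<kappa>" and "\<delta> > 0"
    and an: "\<And>i. real_analytic (\<psi> i)"
  shows "(1 / real N) * (\<Sum>i=1..N. J_SE C T (a_model \<phi> \<psi> \<theta>) (x i 0) (x i) w)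
    \<le> tr_mult (aleph N) R (M_bar N T w x)"
proof -
  have Th: "(\<theta>, r) \<in> Theta C \<phi> \<psi> N \<delta> Pi_map"
    and r: "\<And>z. r z = (\<Sum>\<alpha>\<in>aleph N. \<Sum>\<beta>\<in>aleph N. R \<alpha> \<beta> * vpow z (\<alpha> + \<beta>))"
    using feas by (auto simp: feasible_def)
  show ?thesis
    unfolding tr_mult_M_bar[OF r]
    by (intro mult_left_mono sum_mono simulation_error_le_sum[OF Th \<open>\<delta> > 0\<close> an]) auto
qed

theorem theorem1:
  fixes M :: "'s measure"
    and C :: "real ^ 'x::enum ^ 'y::finite"
    and \<phi> :: "'k::finite \<Rightarrow> (real ^ 'x::enum) \<times> (real ^ 'w::enum) \<Rightarrow> real ^ 'x::enum"
    and \<psi> :: "'k \<Rightarrow> real ^ 'x::enum \<Rightarrow> real ^ 'x::enum"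
    and N :: nat
    and w :: "nat \<Rightarrow> 's \<Rightarrow> real ^ 'w::enum"
    and xb v :: "nat \<Rightarrow> nat \<Rightarrow> 's \<Rightarrow> real ^ 'x::enum"
    and \<delta> :: real
    and Pi_map :: "real ^ ('x + 'x + 'w + 'x + 'x) \<Rightarrow> real ^ 'p::finite"
    and \<kappa> :: ereal
    and \<theta>\<^sub>T :: "nat \<Rightarrow> 's \<Rightarrow> real ^ 'k"
    and r\<^sub>T :: "nat \<Rightarrow> 's \<Rightarrow> real ^ ('x + 'x + 'w) \<Rightarrow> real"
    and R\<^sub>T :: "nat \<Rightarrow> 's \<Rightarrow> nat ^ ('x + 'x + 'w) \<Rightarrow> nat ^ ('x + 'x + 'w) \<Rightarrow> real"
  assumes "prob_space M"
    and "N \<ge> 1"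
    and "\<And>i. real_analytic (\<phi> i)"
    and "\<And>i. real_analytic (\<psi> i)"
    and "assm_A1 M w"
    and "assm_A2 M N w xb v"
    and "assm_A3 M N xb"
    and "\<delta> > 0"
    and "0 < \<kappa>" and "\<kappa> < \<infinity>"
    and "\<And>T \<omega>. T \<ge> 1 \<Longrightarrow> \<omega> \<in> space M \<Longrightarrow>
      algorithm_output C \<phi> \<psi> N \<delta> Pi_map \<kappa> T
        (\<lambda>t. w t \<omega>) (\<lambda>i t. xb i t \<omega> + v i t \<omega>) (\<theta>\<^sub>T T \<omega>, r\<^sub>T T \<omega>, R\<^sub>T T \<omega>)"
  shows "\<forall>\<epsilon>>0. \<forall>\<gamma>. 0 < \<gamma> \<and> \<gamma> < 1 \<longrightarrow>
    (\<exists>T\<ge>1. \<exists>A\<in>sets M. measure M A \<ge> 1 - \<gamma> \<and>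
      (\<forall>\<omega>\<in>A. \<forall>(\<theta>, r, R)\<in>feasible C \<phi> \<psi> N \<delta> Pi_map \<kappa>.
        \<epsilon> + tr_mult (aleph N) R (M_bar N T (\<lambda>t. w t \<omega>) (\<lambda>i t. xb i t \<omega>))
          \<ge> tr_mult (aleph N) (R\<^sub>T T \<omega>) (M_bar N T (\<lambda>t. w t \<omega>) (\<lambda>i t. xb i t \<omega>)) \<and>
        tr_mult (aleph N) (R\<^sub>T T \<omega>) (M_bar N T (\<lambda>t. w t \<omega>) (\<lambda>i t. xb i t \<omega>))
          \<ge> (1 / real N) * (\<Sum>i=1..N.
              J_SE C T (a_model \<phi> \<psi> (\<theta>\<^sub>T T \<omega>)) (xb i 0 \<omega>) (\<lambda>t. xb i t \<omega>) (\<lambda>t. w t \<omega>))))"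
proof (intro allI impI)
  fix \<epsilon> \<gamma> :: real assume \<epsilon>: "\<epsilon> > 0" and \<gamma>: "0 < \<gamma> \<and> \<gamma> < 1"
  interpret noisy_data M N w xb v
    using assms(1,2,5-7) by (intro noisy_data.intro noisy_data_axioms.intro)
  let ?I = "aleph N :: (nat ^ ('x + 'x + 'w)) set"
  obtain \<kappa>' where \<kappa>': "\<kappa> = ereal \<kappa>'" "\<kappa>' > 0"
    using \<open>0 < \<kappa>\<close> \<open>\<kappa> < \<infinity>\<close> by (cases \<kappa>) auto
  define K where "K = sqrt \<kappa>'"
  define m where "m = real ((card ?I)\<^sup>2)"
  \<comment> \<open>The 4 is 2 * 2: projecting doubles the error, which then enters at both candidates.
      Adding 1 to \<open>m\<close> keeps the denominator positive.\<close>
  define \<eta> where "\<eta> = \<epsilon> / (4 * K * (m + 1))"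
  have K: "K > 0" using \<kappa>' by (simp add: K_def)
  have m: "m \<ge> 0" by (simp add: m_def)
  have \<eta>: "\<eta> > 0" using \<epsilon> K m by (simp add: \<eta>_def)
  have small: "2 * (K * (2 * (m * \<eta>))) \<le> \<epsilon>"
  proof -
    have "2 * (K * (2 * (m * \<eta>))) \<le> 4 * K * (m + 1) * \<eta>"
      using K m \<eta> by (simp add: algebra_simps)
    also have "\<dots> = \<epsilon>" using K m by (simp add: \<eta>_def)
    finally show ?thesis .
  qed
  have frob_K: "frob ?I R \<le> K" if "(\<theta>, r, R) \<in> feasible C \<phi> \<psi> N \<delta> Pi_map \<kappa>" for \<theta> r R
    unfolding K_def by (rule real_le_rsqrt) (use that \<kappa>' in \<open>simp add: feasible_def\<close>)
  obtain T A where T: "T \<ge> 1" and A: "A \<in> events" "prob A \<ge> 1 - \<gamma>"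
    and close: "\<And>\<omega> \<alpha>. \<omega> \<in> A \<Longrightarrow> mdeg \<alpha> \<le> N \<Longrightarrow>
      \<bar>lin_moment T (\<lambda>t. w t \<omega>) (\<lambda>i t. xb i t \<omega> + v i t \<omega>) \<alpha>
        - (1 / real N) * (\<Sum>j=1..N. moment T (\<lambda>t. w t \<omega>) (\<lambda>t. xb j t \<omega>) \<alpha>)\<bar> \<le> \<eta>"
    using uniformly_consistent[OF \<eta>] \<gamma> by blast
  show "\<exists>T\<ge>1. \<exists>A\<in>sets M. measure M A \<ge> 1 - \<gamma> \<and>
      (\<forall>\<omega>\<in>A. \<forall>(\<theta>, r, R)\<in>feasible C \<phi> \<psi> N \<delta> Pi_map \<kappa>.
        \<epsilon> + tr_mult (aleph N) R (M_bar N T (\<lambda>t. w t \<omega>) (\<lambda>i t. xb i t \<omega>))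
          \<ge> tr_mult (aleph N) (R\<^sub>T T \<omega>) (M_bar N T (\<lambda>t. w t \<omega>) (\<lambda>i t. xb i t \<omega>)) \<and>
        tr_mult (aleph N) (R\<^sub>T T \<omega>) (M_bar N T (\<lambda>t. w t \<omega>) (\<lambda>i t. xb i t \<omega>))
          \<ge> (1 / real N) * (\<Sum>i=1..N.
              J_SE C T (a_model \<phi> \<psi> (\<theta>\<^sub>T T \<omega>)) (xb i 0 \<omega>) (\<lambda>t. xb i t \<omega>) (\<lambda>t. w t \<omega>)))"
  proof (intro exI[of _ T] bexI[of _ A] conjI ballI T A; clarify)
    fix \<omega> \<theta> r R
    assume \<omega>: "\<omega> \<in> A" and feas: "(\<theta>, r, R) \<in> feasible C \<phi> \<psi> N \<delta> Pi_map \<kappa>"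
    let ?hat = "M_hat N T (\<lambda>t. w t \<omega>) (\<lambda>i t. xb i t \<omega> + v i t \<omega>)"
    let ?bar = "M_bar N T (\<lambda>t. w t \<omega>) (\<lambda>i t. xb i t \<omega>)"
    have "\<omega> \<in> space M" using \<omega> A(1) sets.sets_into_space by blast
    then have out: "algorithm_output C \<phi> \<psi> N \<delta> Pi_map \<kappa> T
        (\<lambda>t. w t \<omega>) (\<lambda>i t. xb i t \<omega> + v i t \<omega>) (\<theta>\<^sub>T T \<omega>, r\<^sub>T T \<omega>, R\<^sub>T T \<omega>)"
      using assms(11) T by blast
    then have feasT: "(\<theta>\<^sub>T T \<omega>, r\<^sub>T T \<omega>, R\<^sub>T T \<omega>) \<in> feasible C \<phi> \<psi> N \<delta> Pi_map \<kappa>"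
      and opt: "tr_mult ?I (R\<^sub>T T \<omega>) ?hat \<le> tr_mult ?I R ?hat"
      using feas by (auto simp: algorithm_output_def is_arg_min_linorder)
    have "frob ?I (\<lambda>\<alpha> \<beta>. ?hat \<alpha> \<beta> - ?bar \<alpha> \<beta>) \<le> 2 * (m * \<eta>)"
      unfolding m_def by (rule M_hat_close) (rule close[OF \<omega>])
    from minimizer_near_optimal[OF opt this frob_K[OF feasT] frob_K[OF feas]]
    have "tr_mult ?I (R\<^sub>T T \<omega>) ?bar \<le> \<epsilon> + tr_mult ?I R ?bar"
      using small by linarith
    moreover have "(1 / real N) * (\<Sum>i=1..N.
        J_SE C T (a_model \<phi> \<psi> (\<theta>\<^sub>T T \<omega>)) (xb i 0 \<omega>) (\<lambda>t. xb i t \<omega>) (\<lambda>t. w t \<omega>))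
      \<le> tr_mult ?I (R\<^sub>T T \<omega>) ?bar"
      by (rule average_simulation_error_le_trace[OF feasT assms(8,4)])
    ultimately show "\<epsilon> + tr_mult ?I R ?bar \<ge> tr_mult ?I (R\<^sub>T T \<omega>) ?bar \<and>
        tr_mult ?I (R\<^sub>T T \<omega>) ?bar \<ge> (1 / real N) * (\<Sum>i=1..N.
          J_SE C T (a_model \<phi> \<psi> (\<theta>\<^sub>T T \<omega>)) (xb i 0 \<omega>) (\<lambda>t. xb i t \<omega>) (\<lambda>t. w t \<omega>))" ..
  qed
qed

end
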